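(* Let $G$ be a countable locally finite group. Then the set of actions of $G$ on $C(2^{\mathbb{N}})$ by linear isometries that admit an equivalent $G$-invariant strictly convex norm is comeager in $\mathrm{Act}_G(C(2^{\mathbb{N}}))$.
   Context: $2^{\mathbb{N}}$ is the Cantor space and $C(2^{\mathbb{N}})$ the real Banach space of continuous functions on it with the sup norm. $\mathrm{Iso}(C(2^{\mathbb{N}}))$ is the group of surjective linear isometries with the strong operator topology, and $\mathrm{Act}_G(C(2^{\mathbb{N}}))$ is the set of homomorphisms $G\to\mathrm{Iso}(C(2^{\mathbb{N}}))$, viewed as a closed subset of $\mathrm{Iso}(C(2^{\mathbb{N}}))^G$ with the product topology (a Polish space). A group is locally finite if every finitely generated subgroup is finite. A norm is $G$-invariant if each $g$ acts isometrically for it; strictly convex if for $f\neq h$ of equal norm, $\|\frac{f+h}{2}\|<\|f\|$. *)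

theory Defs
  imports "HOL-Analysis.Analysis" "HOL-Algebra.Generated_Groups"
begin

text \<open>Cantor space 2^N is the type nat => bool with the product topology of the
discrete space bool (the instance from Function_Topology). Since it is compact,
C(2^N) with the sup norm is the Banach space of bounded continuous functions.\<close>

type_synonym cantor_C = "(nat \<Rightarrow> bool, real) bcontfun"

definition Iso_C :: "(cantor_C \<Rightarrow> cantor_C) set" where
  "Iso_C = {T. linear T \<and> surj T \<and> (\<forall>f. norm (T f) = norm f)}"

text \<open>Strong operator topology: pointwise convergence in norm, i.e. the product
topology on functions restricted to Iso_C.\<close>
definition SOT_Iso :: "(cantor_C \<Rightarrow> cantor_C) topology" where
  "SOT_Iso = subtopology (product_topology (\<lambda>_. euclidean) UNIV) Iso_C"

definition Act_top :: "('g, 'b) monoid_scheme \<Rightarrow> ('g \<Rightarrow> cantor_C \<Rightarrow> cantor_C) topology" where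
  "Act_top G = subtopology (product_topology (\<lambda>_. SOT_Iso) (carrier G))
     {\<rho> \<in> topspace (product_topology (\<lambda>_. SOT_Iso) (carrier G)).
        \<forall>g \<in> carrier G. \<forall>h \<in> carrier G. \<rho> (g \<otimes>\<^bsub>G\<^esub> h) = \<rho> g \<circ> \<rho> h}"

definition locally_finite_group :: "('g, 'b) monoid_scheme \<Rightarrow> bool" where
  "locally_finite_group G \<longleftrightarrow>
     (\<forall>S. S \<subseteq> carrier G \<and> finite S \<longrightarrow> finite (generate G S))"

definition is_norm_on :: "('v::real_vector \<Rightarrow> real) \<Rightarrow> bool" where
  "is_norm_on N \<longleftrightarrow> (\<forall>x. N x \<ge> 0) \<and> (\<forall>x. N x = 0 \<longleftrightarrow> x = 0)
     \<and> (\<forall>c x. N (c *\<^sub>R x) = \<bar>c\<bar> * N x) \<and> (\<forall>x y. N (x + y) \<le> N x + N y)"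

definition equivalent_norm :: "('v::real_normed_vector \<Rightarrow> real) \<Rightarrow> bool" where
  "equivalent_norm N \<longleftrightarrow> is_norm_on N \<and>
     (\<exists>a b. a > 0 \<and> b > 0 \<and> (\<forall>x. a * norm x \<le> N x \<and> N x \<le> b * norm x))"

definition strictly_convex_norm :: "('v::real_vector \<Rightarrow> real) \<Rightarrow> bool" where
  "strictly_convex_norm N \<longleftrightarrow>
     (\<forall>f h. f \<noteq> h \<and> N f = N h \<longrightarrow> N ((1/2) *\<^sub>R (f + h)) < N f)"

definition invariant_norm :: "'g set \<Rightarrow> ('g \<Rightarrow> 'v \<Rightarrow> 'v) \<Rightarrow> ('v \<Rightarrow> real) \<Rightarrow> bool" where
  "invariant_norm A \<rho> N \<longleftrightarrow> (\<forall>g \<in> A. \<forall>x. N (\<rho> g x) = N x)"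

definition nowhere_dense_in :: "'a topology \<Rightarrow> 'a set \<Rightarrow> bool" where
  "nowhere_dense_in X A \<longleftrightarrow> X interior_of (X closure_of A) = {}"

definition meager_in :: "'a topology \<Rightarrow> 'a set \<Rightarrow> bool" where
  "meager_in X A \<longleftrightarrow> (\<exists>F. countable F \<and> (\<forall>N \<in> F. nowhere_dense_in X N) \<and> A \<subseteq> \<Union>F)"

definition comeager_in :: "'a topology \<Rightarrow> 'a set \<Rightarrow> bool" where
  "comeager_in X A \<longleftrightarrow> meager_in X (topspace X - A)"

end

theory Submission
  imports Defs
begin

text \<open>
  An isometry of \<open>C(2\<^sup>\<nat>)\<close> is a signed composition with a homeomorphism. If \<open>G\<close> is infinite, let
  an action be good if every cylinder is visited by all points under a finite subset of \<open>G\<close>.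
  For a good action the averages of a quadratic form over an increasing sequence of finite
  subgroups exhausting \<open>G\<close> stay bounded away from \<open>0\<close> at every \<open>f \<noteq> 0\<close>; their upper limit \<open>Q\<close> is
  invariant and inherits a strict parallelogram gap, so \<open>sqrt (\<parallel>f\<parallel>\<^sup>2 + Q f)\<close> is the required norm.
  Finite groups need no goodness.

  Good actions form a countable intersection of open sets. They are dense: an action restricted
  to a finite subgroup \<open>H\<close> is, at a given scale, a signed right action of \<open>H\<close> on a finite clopen
  partition. A large finite group \<open>K \<supseteq> H\<close> maps \<open>H\<close>-equivariantly onto this partition, so the
  partition refines to one indexed by \<open>K\<close>. Refining further along larger and larger finite
  subgroups codes every point by a coherent sequence of group elements, and right
  multiplication of the codes defines a good action of \<open>G\<close> close to the given one on \<open>H\<close>.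
\<close>

section \<open>The Cantor space and isometries of its function space\<close>

definition agree :: "nat \<Rightarrow> (nat \<Rightarrow> bool) \<Rightarrow> (nat \<Rightarrow> bool) \<Rightarrow> bool" where
  "agree n x y \<longleftrightarrow> (\<forall>i<n. x i = y i)"

lemma agree_refl [simp]: "agree n x x"
  by (simp add: agree_def)

lemma agree_trans: "agree n x y \<Longrightarrow> agree n y z \<Longrightarrow> agree n x z"
  by (simp add: agree_def)

lemma agree_mono: "agree n x y \<Longrightarrow> m \<le> n \<Longrightarrow> agree m x y"
  by (simp add: agree_def)

lemma agree_all_imp_eq: "(\<And>n. agree n x y) \<Longrightarrow> x = y"
  by (auto simp: agree_def)

lemma agree_iff_map_upt: "agree n x y \<longleftrightarrow> map x [0..<n] = map y [0..<n]"
  by (auto simp: agree_def)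

text \<open>By compactness these are exactly the locally constant maps. Such a map is a finite
  clopen partition with labelled pieces.\<close>

definition finitely_determined :: "((nat \<Rightarrow> bool) \<Rightarrow> 'c) \<Rightarrow> bool" where
  "finitely_determined \<alpha> \<longleftrightarrow> (\<exists>N. \<forall>x y. agree N x y \<longrightarrow> \<alpha> x = \<alpha> y)"

lemma finitely_determinedI:
  "(\<And>x y. agree N x y \<Longrightarrow> \<alpha> x = \<alpha> y) \<Longrightarrow> finitely_determined \<alpha>"
  unfolding finitely_determined_def by blast

lemma finitely_determined_comp:
  "finitely_determined \<alpha> \<Longrightarrow> finitely_determined (\<lambda>x. F (\<alpha> x))"
  unfolding finitely_determined_def by metis

lemma finitely_determined_Pair:
  assumes "finitely_determined \<alpha>" "finitely_determined \<beta>"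
  shows "finitely_determined (\<lambda>x. (\<alpha> x, \<beta> x))"
proof -
  obtain M where M: "\<And>x y. agree M x y \<Longrightarrow> \<alpha> x = \<alpha> y"
    using assms(1) unfolding finitely_determined_def by blast
  obtain N where N: "\<And>x y. agree N x y \<Longrightarrow> \<beta> x = \<beta> y"
    using assms(2) unfolding finitely_determined_def by blast
  show ?thesis
  proof (rule finitely_determinedI)
    fix x y assume "agree (max M N) x y"
    then have "agree M x y" "agree N x y" by (auto elim: agree_mono)
    then show "(\<alpha> x, \<beta> x) = (\<alpha> y, \<beta> y)" by (metis M N)
  qed
qed

text \<open>Finitely many depths have a maximum. \<open>restrict\<close> fixes all values off
  \<open>H\<close>, so that the whole tuple can serve as a single code.\<close>

lemma finitely_determined_restrict:
  assumes "finite H" "\<And>h. h \<in> H \<Longrightarrow> finitely_determined (\<lambda>x. F x h)"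
  shows "finitely_determined (\<lambda>x. restrict (F x) H)"
  using assms
proof (induction H)
  case empty
  then show ?case by (intro finitely_determinedI[where N = 0]) (auto simp: restrict_def)
next
  case (insert h H)
  have "finitely_determined (\<lambda>x. (restrict (F x) H, F x h))"
    using insert by (intro finitely_determined_Pair insert.IH) auto
  from finitely_determined_comp[OF this, of "\<lambda>(u, v). u(h := v)"]
  have "finitely_determined (\<lambda>x. (restrict (F x) H)(h := F x h))"
    by simp
  moreover have "(restrict (F x) H)(h := F x h) = restrict (F x) (insert h H)" for x
    by (auto simp: restrict_def)
  ultimately show ?case by (simp only:)
qed

lemma finitely_determined_imp_finite_range:
  assumes "finitely_determined \<alpha>"
  shows "finite (range \<alpha>)"
proof -
  obtain N where N: "\<And>x y. agree N x y \<Longrightarrow> \<alpha> x = \<alpha> y"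
    using assms unfolding finitely_determined_def by blast
  let ?L = "{l :: bool list. set l \<subseteq> UNIV \<and> length l = N}"
  have "range \<alpha> \<subseteq> (\<lambda>l. \<alpha> (\<lambda>i. if i < N then l ! i else False)) ` ?L"
  proof safe
    fix x
    have "\<alpha> x = \<alpha> (\<lambda>i. if i < N then map x [0..<N] ! i else False)"
      by (rule N) (auto simp: agree_def)
    then show "\<alpha> x \<in> (\<lambda>l. \<alpha> (\<lambda>i. if i < N then l ! i else False)) ` ?L"
      by (intro image_eqI[where x = "map x [0..<N]"]) auto
  qed
  moreover have "finite ?L" by (rule finite_lists_length_eq) simp
  ultimately show ?thesis by (meson finite_surj)
qed

section \<open>Compactness and uniform continuity\<close>

lemma compact_cantor: "compact (UNIV :: (nat \<Rightarrow> bool) set)"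
proof -
  have "compact_space (euclidean :: bool topology)"
    by (simp add: compact_space_def finite_imp_compact)
  then have "compact_space (product_topology (\<lambda>_::nat. euclidean :: bool topology) UNIV)"
    by (simp add: compact_space_product_topology)
  then show ?thesis
    by (simp add: euclidean_product_topology compact_space_def)
qed

lemma open_agree: "open {y. agree n x y}"
proof -
  have "open {y. \<forall>i\<in>{..<n}. y i \<in> {x i}}"
    by (rule product_topology_basis'[of "{..<n}" "\<lambda>i. {x i}" "\<lambda>i. i"]) (auto simp: open_discrete)
  then show ?thesis by (simp add: agree_def eq_commute Ball_def)
qed

lemma open_cantor_contains_agree:
  fixes S :: "(nat \<Rightarrow> bool) set"
  assumes "open S" "x \<in> S"
  shows "\<exists>N. \<forall>y. agree N x y \<longrightarrow> y \<in> S"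
proof -
  obtain X where X: "x \<in> Pi\<^sub>E UNIV X" "finite {i. X i \<noteq> UNIV}" "Pi\<^sub>E UNIV X \<subseteq> S"
    using product_topology_open_contains_basis[of "\<lambda>_. euclidean" UNIV S x] assms
    by (auto simp: open_fun_def)
  obtain N where N: "\<And>i. X i \<noteq> UNIV \<Longrightarrow> i < N"
    using X(2) finite_nat_set_iff_bounded by auto
  have "y \<in> S" if "agree N x y" for y
  proof -
    have "y i \<in> X i" for i
    proof (cases "X i = UNIV")
      case False
      then have "y i = x i" using N that by (simp add: agree_def)
      then show ?thesis using X(1) by (auto simp: PiE_iff)
    qed auto
    then show ?thesis using X(3) by auto
  qed
  then show ?thesis by blast
qed

text \<open>Heine-Cantor, with depth of agreement in the role of distance: compactness gives one
  depth that works at all points.\<close>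

lemma continuous_cantor_iff:
  fixes f :: "(nat \<Rightarrow> bool) \<Rightarrow> real"
  shows "continuous_on UNIV f \<longleftrightarrow> (\<forall>e>0. \<exists>N. \<forall>x y. agree N x y \<longrightarrow> \<bar>f x - f y\<bar> < e)"
    (is "?L \<longleftrightarrow> ?R")
proof
  assume L: ?L
  show ?R
  proof (intro allI impI)
    fix e :: real assume e: "e > 0"
    \<comment> \<open>Half of \<open>e\<close> for each of two points that will be compared through
      the centre of a common cylinder.\<close>
    have "\<exists>n. \<forall>y. agree n x y \<longrightarrow> \<bar>f x - f y\<bar> < e / 2" for x
    proof -
      have "open (f -` ball (f x) (e / 2))"
        using L by (simp add: continuous_on_open_vimage)
      from open_cantor_contains_agree[OF this, of x] e show ?thesis
        by (auto simp: dist_real_def)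
    qed
    then obtain n where n: "\<And>x y. agree (n x) x y \<Longrightarrow> \<bar>f x - f y\<bar> < e / 2" by metis
    obtain C where C: "finite C" "UNIV \<subseteq> (\<Union>x\<in>C. {y. agree (n x) x y})"
    proof (rule compactE_image[OF compact_cantor])
      show "open {y. agree (n x) x y}" for x by (rule open_agree)
      show "UNIV \<subseteq> (\<Union>x\<in>UNIV. {y. agree (n x) x y})" by auto
    qed auto
    define N where "N = Max (insert 0 (n ` C))"
    have "\<bar>f x - f y\<bar> < e" if "agree N x y" for x y
    proof -
      obtain z where z: "z \<in> C" "agree (n z) z x" using C by auto
      have "n z \<le> N" unfolding N_def using C z by (intro Max_ge) auto
      then have "agree (n z) z y" using z that agree_mono agree_trans by blast
      with n[OF z(2)] n[of z y] show ?thesis by linarith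
    qed
    then show "\<exists>N. \<forall>x y. agree N x y \<longrightarrow> \<bar>f x - f y\<bar> < e" by blast
  qed
next
  assume R: ?R
  show ?L
    unfolding continuous_on_topological
  proof (intro ballI allI impI)
    fix x B assume B: "open B" "f x \<in> B"
    then obtain e where e: "e > 0" "ball (f x) e \<subseteq> B" by (meson openE)
    obtain N where N: "\<And>x y. agree N x y \<Longrightarrow> \<bar>f x - f y\<bar> < e" using R e by blast
    have "\<forall>y\<in>UNIV. y \<in> {y. agree N x y} \<longrightarrow> f y \<in> B"
      using N e by (auto simp: dist_real_def subset_iff)
    then show "\<exists>A. open A \<and> x \<in> A \<and> (\<forall>y\<in>UNIV. y \<in> A \<longrightarrow> f y \<in> B)"
      by (intro exI[of _ "{y. agree N x y}"]) (auto simp: open_agree)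
  qed
qed

lemma continuous_on_finitely_determined:
  fixes f :: "(nat \<Rightarrow> bool) \<Rightarrow> real"
  assumes "finitely_determined f"
  shows "continuous_on UNIV f"
proof -
  obtain N where "\<And>x y. agree N x y \<Longrightarrow> f x = f y"
    using assms unfolding finitely_determined_def by blast
  then show ?thesis unfolding continuous_cantor_iff by (auto intro!: exI[of _ N])
qed

lemma cantor_C_uniform:
  fixes f :: cantor_C
  assumes "e > 0"
  obtains N where "\<And>x y. agree N x y \<Longrightarrow> \<bar>f x - f y\<bar> < e"
  using continuous_on_apply_bcontfun[of UNIV f] assms unfolding continuous_cantor_iff by blast

lemma continuous_cantor_bcontfun:
  fixes f :: "(nat \<Rightarrow> bool) \<Rightarrow> real"
  assumes "continuous_on UNIV f"
  shows "f \<in> bcontfun"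
  using assms compact_imp_bounded[OF compact_continuous_image[OF assms compact_cantor]]
  by (simp add: bcontfun_def)

lemma apply_Bcontfun_cantor [simp]:
  fixes f :: "(nat \<Rightarrow> bool) \<Rightarrow> real"
  assumes "continuous_on UNIV f"
  shows "apply_bcontfun (Bcontfun f) = f"
  by (simp add: assms Bcontfun_inverse continuous_cantor_bcontfun)

definition coord :: "nat \<Rightarrow> cantor_C" where
  "coord i = Bcontfun (\<lambda>x. of_bool (x i))"

lemma coord_apply [simp]: "coord i x = of_bool (x i)"
proof -
  have "continuous_on UNIV (\<lambda>x :: nat \<Rightarrow> bool. of_bool (x i) :: real)"
    by (intro continuous_on_finitely_determined finitely_determinedI[where N = "Suc i"])
       (auto simp: agree_def)
  then show ?thesis by (simp add: coord_def)
qed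

lemma norm_cantor_C_le:
  fixes f :: cantor_C
  shows "(\<And>x. \<bar>f x\<bar> \<le> b) \<Longrightarrow> norm f \<le> b"
  by (rule norm_bound) simp

lemma abs_le_norm_cantor_C:
  fixes f :: cantor_C
  shows "\<bar>f x\<bar> \<le> norm f"
  using norm_bounded[of f x] by simp

section \<open>Surjective isometries and the Banach-Stone representation\<close>

lemma Iso_CD:
  assumes "T \<in> Iso_C"
  shows "T (f + g) = T f + T g" "T (f - g) = T f - T g" "T (c *\<^sub>R f) = c *\<^sub>R T f" "T 0 = 0"
    "norm (T f) = norm f" "\<exists>h. T h = f" "T f = T g \<longleftrightarrow> f = g"
proof -
  have lin: "linear T" and n: "\<And>f. norm (T f) = norm f" and s: "surj T"
    using assms by (auto simp: Iso_C_def)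
  show "T (f + g) = T f + T g" "T (c *\<^sub>R f) = c *\<^sub>R T f"  "T 0 = 0"
    and d: "T (f - g) = T f - T g"
    using lin by (simp_all add: linear_add linear_diff linear_scale linear_0)
  show "norm (T f) = norm f" by (rule n)
  show "\<exists>h. T h = f" using s by (metis surjD)
  show "T f = T g \<longleftrightarrow> f = g" using d n[of "f - g"] by auto
qed

text \<open>Unimodular functions are the extreme points of the unit ball, and a surjective
isometry permutes those.\<close>

lemma Iso_C_unimodular:
  fixes e :: cantor_C
  assumes T: "T \<in> Iso_C" and e: "\<And>x. \<bar>e x\<bar> = 1"
  shows "\<bar>T e x\<bar> = 1"
proof -
  \<comment> \<open>\<open>g\<close> is the slack that \<open>T e\<close> leaves in the unit ball,
    so \<open>T e + g\<close> and \<open>T e - g\<close> stay in the ball. So do their preimages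
    \<open>e + u\<close> and \<open>e - u\<close>, which forces \<open>u = 0\<close> because
    \<open>e\<close> has modulus one.\<close>
  define g where "g = Bcontfun (\<lambda>x. 1 - \<bar>T e x\<bar>)"
  have g: "g x = 1 - \<bar>T e x\<bar>" for x
    unfolding g_def by (subst apply_Bcontfun_cantor) (auto intro!: continuous_intros)
  obtain u where u: "T u = g" using Iso_CD(6)[OF T] by blast
  have "norm e \<le> 1" by (rule norm_cantor_C_le) (simp add: e)
  then have "norm (T e) \<le> 1" by (simp add: Iso_CD[OF T])
  then have le: "\<bar>T e x\<bar> \<le> 1" for x using abs_le_norm_cantor_C[of "T e" x] by linarith
  have "\<bar>(T e + g) x\<bar> \<le> 1" "\<bar>(T e - g) x\<bar> \<le> 1" for x
    using le[of x] g[of x] by auto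
  then have "norm (T e + g) \<le> 1" "norm (T e - g) \<le> 1"
    by (auto intro!: norm_cantor_C_le)
  then have "norm (e + u) \<le> 1" "norm (e - u) \<le> 1"
    using u by (metis Iso_CD(1,5)[OF T], metis Iso_CD(2,5)[OF T])
  then have "\<bar>e x + u x\<bar> \<le> 1" "\<bar>e x - u x\<bar> \<le> 1" for x
    using abs_le_norm_cantor_C[of "e + u" x] abs_le_norm_cantor_C[of "e - u" x] by auto
  then have "u x = 0" for x
    using e[of x] \<open>\<And>x. \<bar>e x + u x\<bar> \<le> 1\<close>[of x] \<open>\<And>x. \<bar>e x - u x\<bar> \<le> 1\<close>[of x] by linarith
  then have "u = 0" by (intro bcontfun_eqI) simp
  then have "g = 0" using u Iso_CD(4)[OF T] by simp
  then show ?thesis using g[of x] by simp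
qed

definition iso_sign :: "(cantor_C \<Rightarrow> cantor_C) \<Rightarrow> (nat \<Rightarrow> bool) \<Rightarrow> real" where
  "iso_sign T x = T (const_bcontfun 1) x"

text \<open>If \<open>T\<close> is a signed composition with a point map, then
  \<open>T (coord i) x\<close> is the sign times coordinate \<open>i\<close> of the image of
  \<open>x\<close>; being nonzero reads off that coordinate.\<close>

definition iso_point :: "(cantor_C \<Rightarrow> cantor_C) \<Rightarrow> (nat \<Rightarrow> bool) \<Rightarrow> nat \<Rightarrow> bool" where
  "iso_point T x = (\<lambda>i. T (coord i) x \<noteq> 0)"

lemma abs_iso_sign [simp]:
  assumes "T \<in> Iso_C" shows "\<bar>iso_sign T x\<bar> = 1"
  unfolding iso_sign_def by (rule Iso_C_unimodular[OF assms]) simp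

lemma iso_sign_square [simp]:
  assumes "T \<in> Iso_C" shows "iso_sign T x * iso_sign T x = 1"
  using abs_iso_sign[OF assms, of x] by (metis abs_mult_self_eq mult_1)

text \<open>The function \<open>1 - 2 * coord i\<close> is unimodular, and so is its image. Two
  numbers of modulus one that differ by \<open>2 * T (coord i) x\<close> leave only zero and the
  sign as values of \<open>T (coord i) x\<close>.\<close>

lemma iso_coord:
  assumes T: "T \<in> Iso_C"
  shows "iso_sign T x * T (coord i) x = of_bool (iso_point T x i)"
proof -
  let ?e = "const_bcontfun 1 - 2 *\<^sub>R coord i"
  have "\<bar>T ?e x\<bar> = 1" by (rule Iso_C_unimodular[OF T]) auto
  moreover have "T ?e x = iso_sign T x - 2 * T (coord i) x"
    by (simp add: Iso_CD[OF T] iso_sign_def)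
  ultimately show ?thesis
    using abs_iso_sign[OF T, of x] iso_sign_square[OF T, of x]
    by (auto simp: iso_point_def abs_if split: if_splits)
qed

text \<open>Evaluation of \<open>T f\<close> at \<open>x\<close>, corrected by the sign, is a
  positive normalised functional that kills the functions counting wrong coordinates relative to
  \<open>iso_point T x\<close>. Hence it is evaluation at that point.\<close>

lemma banach_stone:
  fixes f :: cantor_C
  assumes T: "T \<in> Iso_C"
  shows "T f x = iso_sign T x * f (iso_point T x)"
proof -
  define y where "y = iso_point T x"
  define L where "L = (\<lambda>f. iso_sign T x * T f x)"
  have L_add: "L (f + g) = L f + L g" and L_diff: "L (f - g) = L f - L g"
    and L_scale: "L (c *\<^sub>R f) = c * L f" for f g c
    by (simp_all add: L_def Iso_CD[OF T] algebra_simps)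
  have L1: "L (const_bcontfun 1) = 1"
    using T by (simp add: L_def flip: iso_sign_def)
  have L_norm: "\<bar>L f\<bar> \<le> norm f" for f
    using abs_le_norm_cantor_C[of "T f" x] T by (simp add: L_def abs_mult Iso_CD)
  \<comment> \<open>A functional of norm at most one with value one at the constant one is positive:
    test it on \<open>norm f\<close> minus \<open>f\<close>.\<close>
  have L_pos: "0 \<le> L f" if "\<And>z. 0 \<le> f z" for f :: cantor_C
  proof -
    have "norm (norm f *\<^sub>R const_bcontfun 1 - f) \<le> norm f"
    proof (rule norm_cantor_C_le)
      fix z show "\<bar>(norm f *\<^sub>R const_bcontfun 1 - f) z\<bar> \<le> norm f"
        using that[of z] abs_le_norm_cantor_C[of f z] by simp
    qed
    then show ?thesis
      using L_norm[of "norm f *\<^sub>R const_bcontfun 1 - f"] by (simp add: L_diff L_scale L1)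
  qed
  define d where "d = (\<lambda>i. if y i then const_bcontfun 1 - coord i else coord i)"
  have d: "d i z = of_bool (z i \<noteq> y i)" for i z by (auto simp: d_def)
  have Ld: "L (d i) = 0" for i
    using iso_coord[OF T, of x i] by (auto simp: d_def L_diff L1 y_def) (auto simp: L_def)
  \<comment> \<open>\<open>D n z\<close> counts the coordinates below \<open>n\<close> at which
    \<open>z\<close> differs from \<open>y\<close>. It is at least one off the cylinder of
    \<open>y\<close>, yet \<open>L\<close> vanishes on it.\<close>
  define D where "D n = (\<Sum>i<n. d i)" for n
  have D_Suc: "D (Suc n) = D n + d n" "D 0 = 0" for n by (simp_all add: D_def)
  have LD: "L (D n) = 0" for n
  proof (induction n)
    case 0
    have "L 0 = 0" by (simp add: L_def Iso_CD[OF T])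
    then show ?case by (simp add: D_Suc)
  qed (simp add: D_Suc L_add Ld)
  have D0: "0 \<le> D n z" for n z
    by (induction n) (auto simp: D_Suc d)
  have D1: "1 \<le> D n z" if "\<not> agree n y z" for n z
    using that
  proof (induction n)
    case (Suc n)
    then show ?case using D0[of n z]
      by (cases "agree n y z") (auto simp: D_Suc d agree_def less_Suc_eq)
  qed (auto simp: agree_def)
  have "\<bar>L f - f y\<bar> \<le> e" if "e > 0" for e
  proof -
    obtain n where n: "\<And>x y. agree n x y \<Longrightarrow> \<bar>f x - f y\<bar> < e"
      using cantor_C_uniform[OF \<open>e > 0\<close>, of f] by metis
    \<comment> \<open>On the cylinder of \<open>y\<close> the constant \<open>e\<close> bounds the
      variation of \<open>f\<close>; off it the term with \<open>D n\<close> absorbs the bound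
      \<open>2 * norm f\<close>. Under \<open>L\<close> only \<open>e\<close> survives.\<close>
    define M where "M = 2 * norm f"
    let ?B = "e *\<^sub>R const_bcontfun 1 + M *\<^sub>R D n"
    have bd: "\<bar>f z - f y\<bar> \<le> e + M * D n z" for z
    proof (cases "agree n y z")
      case True
      have "0 \<le> M * D n z" using D0[of n z] by (simp add: M_def)
      with n[OF True] show ?thesis by linarith
    next
      case False
      have "M * 1 \<le> M * D n z" using D1[OF False] by (intro mult_left_mono) (auto simp: M_def)
      then show ?thesis using abs_le_norm_cantor_C[of f z] abs_le_norm_cantor_C[of f y] that
        unfolding M_def by linarith
    qed
    have "0 \<le> L (?B - (f - f y *\<^sub>R const_bcontfun 1))" "0 \<le> L (?B + (f - f y *\<^sub>R const_bcontfun 1))"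
    proof -
      have "0 \<le> (?B - (f - f y *\<^sub>R const_bcontfun 1)) z"
        "0 \<le> (?B + (f - f y *\<^sub>R const_bcontfun 1)) z" for z
        using bd[of z] by (simp_all add: abs_le_iff)
      then show "0 \<le> L (?B - (f - f y *\<^sub>R const_bcontfun 1))"
        "0 \<le> L (?B + (f - f y *\<^sub>R const_bcontfun 1))"
        by (blast intro: L_pos)+
    qed
    then show ?thesis by (simp add: L_add L_diff L_scale L1 LD)
  qed
  then have "L f = f y"
    using field_le_epsilon[of "\<bar>L f - f y\<bar>" 0] by simp
  then have "iso_sign T x * (iso_sign T x * T f x) = iso_sign T x * f y" by (simp add: L_def)
  then show ?thesis using iso_sign_square[OF T, of x] by (simp add: y_def flip: mult.assoc)
qed

section \<open>Invariant norms from averaged quadratic forms\<close>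

text \<open>This is the upper limit, kept inside the reals. The averages it is applied to are
  bounded, but their convergence is not established.\<close>

definition ultimate_sup :: "(nat \<Rightarrow> real) \<Rightarrow> real" where
  "ultimate_sup a = Inf {y. \<exists>m. \<forall>n\<ge>m. a n \<le> y}"

lemma ultimate_sup_le:
  assumes "\<And>n. 0 \<le> a n" "\<And>n. m \<le> n \<Longrightarrow> a n \<le> y"
  shows "ultimate_sup a \<le> y"
  unfolding ultimate_sup_def
proof (rule cInf_lower)
  show "bdd_below {y. \<exists>m. \<forall>n\<ge>m. a n \<le> y}"
    by (rule bdd_belowI[of _ 0]) (use assms(1) order_trans in blast)
qed (use assms(2) in blast)

lemma ultimate_sup_ge:
  assumes "\<And>n. c \<le> a n" "\<And>n. a n \<le> M"
  shows "c \<le> ultimate_sup a"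
  unfolding ultimate_sup_def
  by (rule cInf_greatest) (use assms order_trans in blast)+

lemma ultimate_sup_approx:
  assumes "\<And>n. a n \<le> M" "e > 0"
  shows "\<exists>m. \<forall>n\<ge>m. a n \<le> ultimate_sup a + e"
proof -
  have "{y. \<exists>m. \<forall>n\<ge>m. a n \<le> y} \<noteq> {}" using assms(1) by blast
  from cInf_lessD[OF this, of "ultimate_sup a + e"] assms(2)
  obtain y m where "\<forall>n\<ge>m. a n \<le> y" "y < ultimate_sup a + e"
    by (auto simp: ultimate_sup_def)
  then show ?thesis by (intro exI[of _ m]) (auto intro: order_trans less_imp_le)
qed

text \<open>Only tails matter. This yields invariance later, since a group element is known to lie
  in the finite subgroups only from some stage on.\<close>

lemma ultimate_sup_cong:
  assumes "\<And>n. m \<le> n \<Longrightarrow> a n = b n"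
  shows "ultimate_sup a = ultimate_sup b"
proof -
  have "(\<exists>m. \<forall>n\<ge>m. a n \<le> y) \<longleftrightarrow> (\<exists>m. \<forall>n\<ge>m. b n \<le> y)" for y
    using assms by (metis max.bounded_iff order_refl)
  then show ?thesis by (simp add: ultimate_sup_def)
qed

text \<open>A gap that is uniform in \<open>n\<close> survives the passage to the upper limit. With
  \<open>c = 0\<close> this gives convexity, with \<open>c > 0\<close> strict convexity.\<close>

lemma ultimate_sup_convex:
  assumes a: "\<And>n. a n \<le> A" and b: "\<And>n. b n \<le> B" and z: "\<And>n. 0 \<le> z n"
    and t: "0 \<le> t" "t \<le> 1"
    and gap: "\<And>n. m \<le> n \<Longrightarrow> z n + c \<le> t * a n + (1 - t) * b n"
  shows "ultimate_sup z + c \<le> t * ultimate_sup a + (1 - t) * ultimate_sup b"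
proof (rule field_le_epsilon)
  fix e :: real assume e: "e > 0"
  obtain k where k: "\<And>n. n \<ge> k \<Longrightarrow> a n \<le> ultimate_sup a + e"
    using ultimate_sup_approx[of a A e] a e by blast
  obtain l where l: "\<And>n. n \<ge> l \<Longrightarrow> b n \<le> ultimate_sup b + e"
    using ultimate_sup_approx[of b B e] b e by blast
  have "ultimate_sup z \<le> t * ultimate_sup a + (1 - t) * ultimate_sup b + e - c"
  proof (rule ultimate_sup_le[OF z, where m = "max m (max k l)"])
    fix n assume n: "max m (max k l) \<le> n"
    have "t * a n \<le> t * (ultimate_sup a + e)" "(1 - t) * b n \<le> (1 - t) * (ultimate_sup b + e)"
      using k[of n] l[of n] n t by (auto intro!: mult_left_mono)
    with gap[of n] n show "z n \<le> t * ultimate_sup a + (1 - t) * ultimate_sup b + e - c"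
      by (simp add: algebra_simps)
  qed
  then show "ultimate_sup z + c \<le> t * ultimate_sup a + (1 - t) * ultimate_sup b + e" by simp
qed

lemma ultimate_sup_scale:
  assumes a: "\<And>n. 0 \<le> a n" "\<And>n. a n \<le> M" and c: "0 \<le> c"
  shows "ultimate_sup (\<lambda>n. c * a n) = c * ultimate_sup a"
proof -
  \<comment> \<open>One inequality for positive factors is enough: applied to \<open>c\<close> and
    to \<open>inverse c\<close> it gives both directions.\<close>
  have le: "ultimate_sup (\<lambda>n. d * b n) \<le> d * ultimate_sup b"
    if b: "\<And>n. 0 \<le> b n" "\<And>n. b n \<le> B" "0 < d" for d B b
  proof (rule field_le_epsilon)
    fix e :: real assume e: "e > 0"
    obtain m where m: "\<And>n. n \<ge> m \<Longrightarrow> b n \<le> ultimate_sup b + e / d"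
      using ultimate_sup_approx[of b B "e / d"] b e by (metis divide_pos_pos)
    show "ultimate_sup (\<lambda>n. d * b n) \<le> d * ultimate_sup b + e"
    proof (rule ultimate_sup_le[where m = m])
      fix n assume "m \<le> n"
      from mult_left_mono[OF m[OF this], of d] show "d * b n \<le> d * ultimate_sup b + e"
        using b(3) by (simp add: distrib_left)
    qed (use b in auto)
  qed
  show ?thesis
  proof (cases "c = 0")
    case True
    then show ?thesis
      using ultimate_sup_le[of "\<lambda>_. 0" 0 0] ultimate_sup_ge[of 0 "\<lambda>_. 0" 0] by simp
  next
    case False
    then have c: "c > 0" using c by simp
    have "ultimate_sup (\<lambda>n. inverse c * (c * a n)) \<le> inverse c * ultimate_sup (\<lambda>n. c * a n)"
      by (rule le[where B = "c * M"]) (use a c in \<open>auto intro!: mult_left_mono\<close>)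
    then have "c * ultimate_sup a \<le> ultimate_sup (\<lambda>n. c * a n)"
      using c by (simp add: field_simps)
    moreover have "ultimate_sup (\<lambda>n. c * a n) \<le> c * ultimate_sup a"
      by (rule le[where B = M]) (use a c in auto)
    ultimately show ?thesis by simp
  qed
qed

section \<open>Norms from convex functions of degree two\<close>

lemma norm_square_convex:
  fixes x y :: "'v::real_normed_vector"
  assumes "0 \<le> t" "t \<le> 1"
  shows "(norm (t *\<^sub>R x + (1 - t) *\<^sub>R y))\<^sup>2 \<le> t * (norm x)\<^sup>2 + (1 - t) * (norm y)\<^sup>2"
proof -
  have "norm (t *\<^sub>R x + (1 - t) *\<^sub>R y) \<le> t * norm x + (1 - t) * norm y"
    by (rule order_trans[OF norm_triangle_ineq]) (use assms in simp)
  then have "(norm (t *\<^sub>R x + (1 - t) *\<^sub>R y))\<^sup>2 \<le> (t * norm x + (1 - t) * norm y)\<^sup>2"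
    by (intro power_mono) auto
  also have "\<dots> = t * (norm x)\<^sup>2 + (1 - t) * (norm y)\<^sup>2 - t * (1 - t) * (norm x - norm y)\<^sup>2"
    by (simp add: power2_eq_square algebra_simps)
  also have "\<dots> \<le> t * (norm x)\<^sup>2 + (1 - t) * (norm y)\<^sup>2" using assms by simp
  finally show ?thesis .
qed

text \<open>The square of \<open>N\<close> is convex and homogeneous of degree two, so the triangle
  inequality follows by normalising both vectors. The squared norm bounds \<open>N\<close> from
  below, \<open>Qb\<close> bounds it from above, and strictness comes from \<open>Q\<close>
  alone.\<close>

lemma convex_square_imp_norm:
  fixes Q :: "'v::real_normed_vector \<Rightarrow> real"
  assumes Q0: "\<And>x. 0 \<le> Q x" and Qb: "\<And>x. Q x \<le> (norm x)\<^sup>2"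
    and Qs: "\<And>c x. Q (c *\<^sub>R x) = c\<^sup>2 * Q x"
    and convex: "\<And>x y t. 0 \<le> t \<Longrightarrow> t \<le> 1 \<Longrightarrow>
      Q (t *\<^sub>R x + (1 - t) *\<^sub>R y) \<le> t * Q x + (1 - t) * Q y"
    and strict: "\<And>x y. x \<noteq> y \<Longrightarrow> Q ((1/2) *\<^sub>R (x + y)) < (Q x + Q y) / 2"
  defines "N \<equiv> \<lambda>x. sqrt ((norm x)\<^sup>2 + Q x)"
  shows "equivalent_norm N" "strictly_convex_norm N"
proof -
  have N2: "(N x)\<^sup>2 = (norm x)\<^sup>2 + Q x" and N0: "0 \<le> N x" for x
    using Q0[of x] by (auto simp: N_def)
  have N_convex: "(N (t *\<^sub>R x + (1 - t) *\<^sub>R y))\<^sup>2 \<le> t * (N x)\<^sup>2 + (1 - t) * (N y)\<^sup>2"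
    if "0 \<le> t" "t \<le> 1" for t x y
    unfolding N2 using norm_square_convex[OF that, of x y] convex[OF that, of x y]
    by (simp add: algebra_simps)
  have Ns: "N (c *\<^sub>R x) = \<bar>c\<bar> * N x" for c x
  proof -
    have "N (c *\<^sub>R x) = sqrt (c\<^sup>2 * ((norm x)\<^sup>2 + Q x))"
      by (simp add: N_def Qs power_mult_distrib algebra_simps)
    then show ?thesis by (simp add: real_sqrt_mult N_def)
  qed
  have N_ge: "norm x \<le> N x" for x
    by (rule power2_le_imp_le) (use N2[of x] Q0[of x] N0[of x] in auto)
  have N_le: "N x \<le> 2 * norm x" for x
    by (rule power2_le_imp_le)
       (use N2[of x] Qb[of x] in \<open>auto simp: power_mult_distrib intro: order_trans\<close>)
  have Nz: "N x = 0 \<longleftrightarrow> x = 0" for x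
    using N_ge[of x] N_le[of x] by auto
  have tri: "N (x + y) \<le> N x + N y" for x y
  proof (cases "x = 0 \<or> y = 0")
    case False
    then have pos: "N x > 0" "N y > 0" using N0[of x] N0[of y] Nz[of x] Nz[of y] by linarith+
    define s where "s = N x + N y"
    have s: "s > 0" using pos by (simp add: s_def)
    \<comment> \<open>This weight makes the convex combination of the normalised vectors equal to
      \<open>x + y\<close> divided by \<open>s\<close>.\<close>
    define t where "t = N x / s"
    have t: "0 \<le> t" "t \<le> 1" "1 - t = N y / s"
      using pos s by (auto simp: t_def s_def field_simps)
    let ?x = "(1 / N x) *\<^sub>R x" and ?y = "(1 / N y) *\<^sub>R y"
    have "N ?x = 1" "N ?y = 1" using pos by (simp_all add: Ns)
    with N_convex[OF t(1,2), of ?x ?y]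
    have "(N (t *\<^sub>R ?x + (1 - t) *\<^sub>R ?y))\<^sup>2 \<le> 1\<^sup>2" by simp
    then have "N (t *\<^sub>R ?x + (1 - t) *\<^sub>R ?y) \<le> 1" by (rule power2_le_imp_le) simp
    also have "t *\<^sub>R ?x + (1 - t) *\<^sub>R ?y = (1 / s) *\<^sub>R (x + y)"
      unfolding t(3) using pos by (simp add: t_def scaleR_add_right)
    finally have "N (x + y) / s \<le> 1" using s by (simp add: Ns)
    then show ?thesis using s by (simp add: s_def)
  qed (auto simp: N0)
  show "equivalent_norm N"
    unfolding equivalent_norm_def is_norm_on_def
  proof (intro conjI)
    have "\<forall>x. 1 * norm x \<le> N x \<and> N x \<le> 2 * norm x" using N_ge N_le by simp
    then show "\<exists>a b. a > 0 \<and> b > 0 \<and> (\<forall>x. a * norm x \<le> N x \<and> N x \<le> b * norm x)"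
      using zero_less_one zero_less_numeral by metis
  qed (use N0 Nz Ns tri in auto)
  show "strictly_convex_norm N"
    unfolding strictly_convex_norm_def
  proof (intro allI impI, elim conjE)
    fix f h assume fh: "f \<noteq> h" "N f = N h"
    have halves: "a + p < (b + q + (c + r)) / 2" if "a \<le> (b + c) / 2" "p < (q + r) / 2"
      for a b c p q r :: real using that by simp
    have "(norm ((1/2) *\<^sub>R (f + h)))\<^sup>2 \<le> ((norm f)\<^sup>2 + (norm h)\<^sup>2) / 2"
      using norm_square_convex[of "1/2" f h] by (simp add: scaleR_add_right)
    then have "(N ((1/2) *\<^sub>R (f + h)))\<^sup>2 < ((N f)\<^sup>2 + (N h)\<^sup>2) / 2"
      unfolding N2 by (rule halves[OF _ strict[OF fh(1)]])
    then have "(N ((1/2) *\<^sub>R (f + h)))\<^sup>2 < (N f)\<^sup>2" using fh(2) by simp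
    then show "N ((1/2) *\<^sub>R (f + h)) < N f" by (rule power_less_imp_less_base) (rule N0)
  qed
qed

section \<open>A positive quadratic form on the function space\<close>

text \<open>The binary digits of \<open>k\<close>: these are the sequences with finitely many true
  entries, and they meet every cylinder.\<close>

definition dense_point :: "nat \<Rightarrow> nat \<Rightarrow> bool" where
  "dense_point k = (\<lambda>i. i \<in> set_decode k)"

lemma dense_point_agree: "\<exists>k. agree n x (dense_point k)"
proof
  show "agree n x (dense_point (set_encode {i. i < n \<and> x i}))"
    by (auto simp: agree_def dense_point_def)
qed

text \<open>The squared L2 norm for a purely atomic probability measure of full support. Total mass
  one gives the bound by the squared sup norm, full support gives positivity.\<close>

definition dense_form :: "cantor_C \<Rightarrow> real" where
  "dense_form f = (\<Sum>k. (1/2) ^ Suc k * (f (dense_point k))\<^sup>2)"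

lemma square_le_norm_cantor_C:
  fixes f :: cantor_C
  shows "(f x)\<^sup>2 \<le> (norm f)\<^sup>2"
  using abs_le_norm_cantor_C[of f x] by (metis abs_le_square_iff abs_norm_cancel)

lemma dense_form_summable:
  fixes f :: cantor_C
  shows "summable (\<lambda>k. (1/2) ^ Suc k * (f (dense_point k))\<^sup>2)"
proof (rule summable_comparison_test')
  show "summable (\<lambda>k. (1/2) ^ Suc k * (norm f)\<^sup>2)"
    by (intro summable_mult2 sums_summable[OF power_half_series])
  show "norm ((1/2) ^ Suc k * (f (dense_point k))\<^sup>2) \<le> (1/2) ^ Suc k * (norm f)\<^sup>2" for k
    using square_le_norm_cantor_C[of f "dense_point k"]
    by (simp add: abs_mult del: power_Suc)
qed

lemma dense_form_ge:
  fixes f :: cantor_C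
  shows "(1/2) ^ Suc k * (f (dense_point k))\<^sup>2 \<le> dense_form f"
  using sum_le_suminf[OF dense_form_summable, of "{k}" f] by (simp add: dense_form_def)

lemma dense_form_nonneg: "0 \<le> dense_form f"
  unfolding dense_form_def by (intro suminf_nonneg dense_form_summable) simp

lemma dense_form_le: "dense_form f \<le> (norm f)\<^sup>2"
proof -
  have "dense_form f \<le> (\<Sum>k. (1/2) ^ Suc k * (norm f)\<^sup>2)"
    unfolding dense_form_def
    by (intro suminf_le dense_form_summable summable_mult2 sums_summable[OF power_half_series]
          mult_left_mono square_le_norm_cantor_C) simp
  also have "\<dots> = (norm f)\<^sup>2"
    using sums_mult2[OF power_half_series, of "(norm f)\<^sup>2"] by (simp add: sums_iff)
  finally show ?thesis .
qed

lemma dense_form_scale: "dense_form (c *\<^sub>R f) = c\<^sup>2 * dense_form f"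
proof -
  have "dense_form (c *\<^sub>R f) = (\<Sum>k. c\<^sup>2 * ((1/2) ^ Suc k * (f (dense_point k))\<^sup>2))"
    unfolding dense_form_def by (simp add: power_mult_distrib algebra_simps)
  also have "\<dots> = c\<^sup>2 * dense_form f"
    unfolding dense_form_def by (rule suminf_mult[OF dense_form_summable])
  finally show ?thesis .
qed

text \<open>The parallelogram identity with weights. Being an equality, it survives averaging, and
  the term in \<open>f - h\<close> is the gap that makes the final norm strictly convex.\<close>

lemma dense_form_convex:
  "dense_form (t *\<^sub>R f + (1 - t) *\<^sub>R h) + t * (1 - t) * dense_form (f - h)
    = t * dense_form f + (1 - t) * dense_form h"
proof -
  define w where "w = (\<lambda>f :: cantor_C. \<lambda>k. (1/2) ^ Suc k * (f (dense_point k))\<^sup>2)"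
  have w: "w f sums dense_form f" for f
    unfolding w_def dense_form_def by (rule summable_sums[OF dense_form_summable])
  have "(\<lambda>k. w (t *\<^sub>R f + (1 - t) *\<^sub>R h) k + t * (1 - t) * w (f - h) k) sums
      (dense_form (t *\<^sub>R f + (1 - t) *\<^sub>R h) + t * (1 - t) * dense_form (f - h))"
    by (intro sums_add sums_mult w)
  moreover have "w (t *\<^sub>R f + (1 - t) *\<^sub>R h) k + t * (1 - t) * w (f - h) k
      = t * w f k + (1 - t) * w h k" for k
  proof -
    have "u * (t * a + (1 - t) * b)\<^sup>2 + t * (1 - t) * (u * (a - b)\<^sup>2)
      = t * (u * a\<^sup>2) + (1 - t) * (u * b\<^sup>2)" for u a b :: real
      by (simp add: power2_eq_square algebra_simps)
    then show ?thesis by (simp add: w_def del: power_Suc)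
  qed
  moreover have "(\<lambda>k. t * w f k + (1 - t) * w h k) sums (t * dense_form f + (1 - t) * dense_form h)"
    by (intro sums_add sums_mult w)
  ultimately show ?thesis by (simp add: sums_iff)
qed

lemma cantor_C_nonzero_cylinder:
  fixes f :: cantor_C
  assumes "f \<noteq> 0"
  obtains x n d where "d > 0" "\<And>y. agree n x y \<Longrightarrow> d \<le> \<bar>f y\<bar>"
proof -
  obtain x where x: "f x \<noteq> 0" using assms by (metis bcontfun_eqI zero_bcontfun.rep_eq)
  obtain n where n: "\<And>y z. agree n y z \<Longrightarrow> \<bar>f y - f z\<bar> < \<bar>f x\<bar> / 2"
    using cantor_C_uniform[of "\<bar>f x\<bar> / 2" f] x by (metis half_gt_zero zero_less_abs_iff)
  show ?thesis
  proof
    show "\<bar>f x\<bar> / 2 > 0" using x by simp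
    show "\<bar>f x\<bar> / 2 \<le> \<bar>f y\<bar>" if "agree n x y" for y
      using n[OF that] by linarith
  qed
qed

lemma dense_form_pos:
  assumes "f \<noteq> 0" shows "0 < dense_form f"
proof -
  obtain x n d where d: "d > 0" "\<And>y. agree n x y \<Longrightarrow> d \<le> \<bar>f y\<bar>"
    using cantor_C_nonzero_cylinder[OF assms] by metis
  obtain k where "agree n x (dense_point k)" using dense_point_agree by blast
  then have "f (dense_point k) \<noteq> 0" using d by fastforce
  then have "0 < (1/2) ^ Suc k * (f (dense_point k))\<^sup>2" by simp
  then show ?thesis using dense_form_ge[of k f] by linarith
qed

section \<open>Actions and averages over finite subgroups\<close>

lemma topspace_Act_top:
  "\<rho> \<in> topspace (Act_top G) \<longleftrightarrow> \<rho> \<in> carrier G \<rightarrow>\<^sub>E Iso_C \<and>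
     (\<forall>g\<in>carrier G. \<forall>h\<in>carrier G. \<rho> (g \<otimes>\<^bsub>G\<^esub> h) = \<rho> g \<circ> \<rho> h)"
  by (auto simp: Act_top_def SOT_Iso_def)

lemma Act_topD:
  assumes "\<rho> \<in> topspace (Act_top G)"
  shows "g \<in> carrier G \<Longrightarrow> \<rho> g \<in> Iso_C"
    "g \<in> carrier G \<Longrightarrow> h \<in> carrier G \<Longrightarrow> \<rho> (g \<otimes>\<^bsub>G\<^esub> h) f = \<rho> g (\<rho> h f)"
  using assms by (auto simp: topspace_Act_top)

definition form_avg ::
    "('g \<Rightarrow> cantor_C \<Rightarrow> cantor_C) \<Rightarrow> 'g set \<Rightarrow> cantor_C \<Rightarrow> real" where
  "form_avg \<rho> K f = (\<Sum>g\<in>K. dense_form (\<rho> g f)) / card K"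

lemma (in group) sum_subgroup_right_translate:
  assumes K: "subgroup K G" and g: "g \<in> K"
  shows "(\<Sum>k\<in>K. F (k \<otimes> g)) = (\<Sum>k\<in>K. F k)"
proof (rule sum.reindex_bij_witness[where i = "\<lambda>k. k \<otimes> inv g" and j = "\<lambda>k. k \<otimes> g"])
  have gc: "g \<in> carrier G" using subgroup.mem_carrier[OF K g] .
  fix k assume k: "k \<in> K"
  then have kc: "k \<in> carrier G" using subgroup.mem_carrier[OF K] by blast
  show "k \<otimes> g \<otimes> inv g = k" "k \<otimes> inv g \<otimes> g = k"
    using gc kc by (simp_all add: m_assoc)
  show "k \<otimes> g \<in> K" "k \<otimes> inv g \<in> K"
    using K g k by (simp_all add: subgroup.m_closed subgroup.m_inv_closed)
qed simp

text \<open>The assumption \<open>low\<close> isolates what depends on the dynamics: it keeps the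
  gaps of the averages away from zero along the chain, so that the upper limit is strictly convex.
  Invariance holds because each average is invariant under its own subgroup.\<close>

lemma (in group) exists_invariant_strictly_convex_norm:
  assumes \<rho>: "\<rho> \<in> topspace (Act_top G)"
    and K: "\<And>n. subgroup (K n) G" "\<And>n. finite (K n)" "\<And>n. K n \<subseteq> K (Suc n)" "(\<Union>n. K n) = carrier G"
    and low: "\<And>f. f \<noteq> 0 \<Longrightarrow> \<exists>c>0. \<exists>m. \<forall>n\<ge>m. c \<le> form_avg \<rho> (K n) f"
  shows "\<exists>N. equivalent_norm N \<and> invariant_norm (carrier G) \<rho> N \<and> strictly_convex_norm N"
proof -
  have Kc: "g \<in> carrier G" if "g \<in> K n" for g n using subgroup.mem_carrier[OF K(1)] that by blast
  have iso: "\<rho> g \<in> Iso_C" if "g \<in> K n" for g n using Act_topD(1)[OF \<rho> Kc[OF that]] .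
  have card: "card (K n) > 0" for n
    using K(2)[of n] subgroup.one_closed[OF K(1)[of n]] by (auto simp: card_gt_0_iff)
  have avg0: "0 \<le> form_avg \<rho> (K n) f" for n f
    unfolding form_avg_def by (intro divide_nonneg_nonneg sum_nonneg dense_form_nonneg) auto
  have avgb: "form_avg \<rho> (K n) f \<le> (norm f)\<^sup>2" for n f
  proof -
    have "(\<Sum>g\<in>K n. dense_form (\<rho> g f)) \<le> (\<Sum>g\<in>K n. (norm f)\<^sup>2)"
      by (intro sum_mono) (metis dense_form_le Iso_CD(5) iso)
    then show ?thesis using card[of n] by (simp add: form_avg_def field_simps)
  qed
  have avgs: "form_avg \<rho> (K n) (c *\<^sub>R f) = c\<^sup>2 * form_avg \<rho> (K n) f" for n f c
  proof -
    have "(\<Sum>g\<in>K n. dense_form (\<rho> g (c *\<^sub>R f))) = (\<Sum>g\<in>K n. c\<^sup>2 * dense_form (\<rho> g f))"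
      by (intro sum.cong) (auto simp: Iso_CD[OF iso] dense_form_scale)
    then show ?thesis by (simp add: form_avg_def flip: sum_distrib_left)
  qed
  have avgc: "form_avg \<rho> (K n) (t *\<^sub>R f + (1 - t) *\<^sub>R h) + t * (1 - t) * form_avg \<rho> (K n) (f - h)
    = t * form_avg \<rho> (K n) f + (1 - t) * form_avg \<rho> (K n) h" for n f h t
  proof -
    have "(\<Sum>g\<in>K n. dense_form (\<rho> g (t *\<^sub>R f + (1 - t) *\<^sub>R h)) + t * (1 - t) * dense_form (\<rho> g (f - h)))
      = (\<Sum>g\<in>K n. t * dense_form (\<rho> g f) + (1 - t) * dense_form (\<rho> g h))"
      by (intro sum.cong) (auto simp: Iso_CD[OF iso] dense_form_convex)
    then show ?thesis
      by (simp add: form_avg_def sum.distrib add_divide_distrib[symmetric] flip: sum_distrib_left)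
  qed
  have avginv: "form_avg \<rho> (K n) (\<rho> g f) = form_avg \<rho> (K n) f" if "g \<in> K n" for n g f
  proof -
    have "(\<Sum>k\<in>K n. dense_form (\<rho> k (\<rho> g f))) = (\<Sum>k\<in>K n. dense_form (\<rho> (k \<otimes> g) f))"
      by (intro sum.cong) (auto simp: Act_topD(2)[OF \<rho>] Kc[OF that] Kc)
    also have "\<dots> = (\<Sum>k\<in>K n. dense_form (\<rho> k f))"
      by (rule sum_subgroup_right_translate[OF K(1) that])
    finally show ?thesis by (simp add: form_avg_def)
  qed
  define Q where "Q f = ultimate_sup (\<lambda>n. form_avg \<rho> (K n) f)" for f
  define N where "N = (\<lambda>f. sqrt ((norm f)\<^sup>2 + Q f))"
  have Q_convex: "Q (t *\<^sub>R f + (1 - t) *\<^sub>R h) \<le> t * Q f + (1 - t) * Q h"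
    if t: "0 \<le> t" "t \<le> 1" for f h t
  proof -
    have "form_avg \<rho> (K n) (t *\<^sub>R f + (1 - t) *\<^sub>R h) + 0
      \<le> t * form_avg \<rho> (K n) f + (1 - t) * form_avg \<rho> (K n) h" for n
    proof -
      have "0 \<le> t * (1 - t) * form_avg \<rho> (K n) (f - h)"
        using t by (intro mult_nonneg_nonneg avg0) auto
      with avgc[of n t f h] show ?thesis by linarith
    qed
    from ultimate_sup_convex[OF avgb avgb avg0 t this] show ?thesis by (simp add: Q_def)
  qed
  have Q_strict: "Q ((1/2) *\<^sub>R (f + h)) < (Q f + Q h) / 2" if "f \<noteq> h" for f h
  proof -
    obtain c m where c: "c > 0" "\<And>n. n \<ge> m \<Longrightarrow> c \<le> form_avg \<rho> (K n) (f - h)"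
      using low[of "f - h"] \<open>f \<noteq> h\<close> by auto
    \<comment> \<open>At \<open>t = 1/2\<close> the factor \<open>t * (1 - t)\<close> of the gap is
      \<open>1/4\<close>.\<close>
    have "form_avg \<rho> (K n) ((1/2) *\<^sub>R f + (1 - 1/2) *\<^sub>R h) + c / 4
      \<le> 1/2 * form_avg \<rho> (K n) f + (1 - 1/2) * form_avg \<rho> (K n) h" if "m \<le> n" for n
      using avgc[of n "1/2" f h] c(2)[OF that] by simp
    from ultimate_sup_convex[OF avgb avgb avg0 _ _ this]
    have "Q ((1/2) *\<^sub>R f + (1/2) *\<^sub>R h) + c / 4 \<le> 1/2 * Q f + 1/2 * Q h" by (simp add: Q_def)
    then show ?thesis using c(1) by (simp add: scaleR_add_right)
  qed
  have Q0: "0 \<le> Q f" for f unfolding Q_def by (rule ultimate_sup_ge[OF avg0 avgb])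
  have Qb: "Q f \<le> (norm f)\<^sup>2" for f unfolding Q_def by (rule ultimate_sup_le[OF avg0 avgb])
  have Qs: "Q (c *\<^sub>R f) = c\<^sup>2 * Q f" for c f
    unfolding Q_def avgs by (rule ultimate_sup_scale[OF avg0 avgb]) simp
  have "equivalent_norm N" "strictly_convex_norm N"
    unfolding N_def using convex_square_imp_norm[of Q, OF Q0 Qb Qs Q_convex Q_strict] by blast+
  moreover have "N (\<rho> g f) = N f" if g: "g \<in> carrier G" for g f
  proof -
    obtain m where m: "g \<in> K m" using g K(4) by blast
    have "g \<in> K n" if "m \<le> n" for n using lift_Suc_mono_le[of K, OF K(3) that] m by blast
    then have "Q (\<rho> g f) = Q f" unfolding Q_def by (intro ultimate_sup_cong[of m] avginv)
    then show ?thesis using Iso_CD(5)[OF Act_topD(1)[OF \<rho> g]] by (simp add: N_def)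
  qed
  ultimately show ?thesis unfolding invariant_norm_def by blast
qed

section \<open>Syndetic actions\<close>

definition cylinder :: "bool list \<Rightarrow> cantor_C" where
  "cylinder w = Bcontfun (\<lambda>x. of_bool (map x [0..<length w] = w))"

lemma cylinder_apply [simp]: "cylinder w x = of_bool (map x [0..<length w] = w)"
proof -
  have "continuous_on UNIV (\<lambda>x. of_bool (map x [0..<length w] = w) :: real)"
    by (intro continuous_on_finitely_determined finitely_determinedI[where N = "length w"])
       (simp only: agree_iff_map_upt)
  then show ?thesis by (simp add: cylinder_def)
qed

text \<open>For an action by isometries, a nonzero value means that \<open>g\<close> moves
  \<open>x\<close> into the cylinder of \<open>w\<close>; signs play no part. Required for all
  \<open>w\<close>, this says by compactness that every orbit of points is dense.\<close>

definition syndetic_on :: "('g, 'b) monoid_scheme \<Rightarrow> ('g \<Rightarrow> cantor_C \<Rightarrow> cantor_C) \<Rightarrow> bool list \<Rightarrow> bool" where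
  "syndetic_on G \<rho> w \<longleftrightarrow>
     (\<exists>F. finite F \<and> F \<subseteq> carrier G \<and> (\<forall>x. \<exists>g\<in>F. \<rho> g (cylinder w) x \<noteq> 0))"

lemma finite_subset_chain:
  assumes "\<And>n. K n \<subseteq> K (Suc n)" "finite F" "F \<subseteq> (\<Union>n. K n)"
  shows "\<exists>m. \<forall>n\<ge>m. F \<subseteq> K n"
proof -
  have mono: "K m \<subseteq> K n" if "m \<le> n" for m n using lift_Suc_mono_le[of K, OF assms(1) that] .
  from assms(2,3) have "\<exists>m. F \<subseteq> K m"
  proof (induction F)
    case (insert x F)
    then obtain m k where "F \<subseteq> K m" "x \<in> K k" by auto
    then have "insert x F \<subseteq> K (max m k)" using mono[of m "max m k"] mono[of k "max m k"] by auto
    then show ?case by blast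
  qed auto
  then show ?thesis using mono by (meson order_trans)
qed

lemma (in group) locally_finite_chain:
  assumes "countable (carrier G)" "locally_finite_group G"
  obtains K where "\<And>n :: nat. subgroup (K n) G" "\<And>n. finite (K n)" "\<And>n. K n \<subseteq> K (Suc n)"
    "(\<Union>n. K n) = carrier G"
proof
  \<comment> \<open>For a finite carrier this enumeration repeats elements and the chain becomes
    stationary.\<close>
  define e where "e = from_nat_into (carrier G)"
  have ne: "carrier G \<noteq> {}" by blast
  have e: "range e = carrier G"
    unfolding e_def using range_from_nat_into[OF ne assms(1)] .
  define K where "K n = generate G (e ` {..<n})" for n :: nat
  have sub: "e ` {..<n} \<subseteq> carrier G" for n using e by auto
  show "subgroup (K n) G" for n unfolding K_def by (rule generate_is_subgroup[OF sub])
  show "finite (K n)" for n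
    using assms(2) sub[of n] unfolding locally_finite_group_def K_def by blast
  show "K n \<subseteq> K (Suc n)" for n unfolding K_def by (rule mono_generate) auto
  show "(\<Union>n. K n) = carrier G"
  proof
    show "(\<Union>n. K n) \<subseteq> carrier G" unfolding K_def using generate_incl[OF sub] by blast
    show "carrier G \<subseteq> (\<Union>n. K n)"
    proof
      fix g assume "g \<in> carrier G"
      then obtain n where "g = e n" using e by blast
      then have "g \<in> K (Suc n)" unfolding K_def by (intro generate.incl) auto
      then show "g \<in> (\<Union>n. K n)" by blast
    qed
  qed
qed

text \<open>Double counting: for each \<open>k\<close> in \<open>K n\<close> some \<open>g\<close>
  in \<open>F\<close> makes the form of \<open>\<rho> (k \<otimes> g) f\<close> large. Summing over
  \<open>k\<close> and absorbing \<open>g\<close> by right translation counts the average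
  \<open>card F\<close> times, which gives a bound free of \<open>n\<close>.\<close>

lemma (in group) syndetic_imp_form_avg_ge:
  assumes \<rho>: "\<rho> \<in> topspace (Act_top G)"
    and K: "\<And>n. subgroup (K n) G" "\<And>n. finite (K n)" "\<And>n. K n \<subseteq> K (Suc n)" "(\<Union>n. K n) = carrier G"
    and syn: "\<And>w. syndetic_on G \<rho> w" and f: "f \<noteq> 0"
  shows "\<exists>c>0. \<exists>m. \<forall>n\<ge>m. c \<le> form_avg \<rho> (K n) f"
proof -
  obtain x l d where d: "d > 0" "\<And>y. agree l x y \<Longrightarrow> d \<le> \<bar>f y\<bar>"
    using cantor_C_nonzero_cylinder[OF f] by metis
  obtain F where F: "finite F" "F \<subseteq> carrier G"
      "\<And>y. \<exists>g\<in>F. \<rho> g (cylinder (map x [0..<l])) y \<noteq> 0"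
    using syn[of "map x [0..<l]"] unfolding syndetic_on_def by blast
  have visit: "\<exists>g\<in>F. d \<le> \<bar>\<rho> g f y\<bar>" for y
  proof -
    obtain g where g: "g \<in> F" "\<rho> g (cylinder (map x [0..<l])) y \<noteq> 0" using F(3) by blast
    have iso: "\<rho> g \<in> Iso_C" using Act_topD(1)[OF \<rho>] g F by blast
    have "agree l x (iso_point (\<rho> g) y)"
      using g(2) by (simp add: banach_stone[OF iso] agree_iff_map_upt split: if_splits)
    then have "d \<le> \<bar>\<rho> g f y\<bar>" using d(2) iso by (simp add: banach_stone[OF iso] abs_mult)
    then show ?thesis using g by blast
  qed
  have cF: "card F > 0" using F(1) visit by (auto simp: card_gt_0_iff)
  obtain m where m: "\<And>n. n \<ge> m \<Longrightarrow> F \<subseteq> K n"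
    using finite_subset_chain[of K F] K F by auto
  have "d\<^sup>2 / (2 * card F) \<le> form_avg \<rho> (K n) f" if n: "n \<ge> m" for n
  proof -
    have Kc: "g \<in> carrier G" if "g \<in> K n" for g using subgroup.mem_carrier[OF K(1)] that by blast
    have cK: "card (K n) > 0"
      using K(2)[of n] subgroup.one_closed[OF K(1)[of n]] by (auto simp: card_gt_0_iff)
    \<comment> \<open>A single base point suffices: \<open>dense_point 0\<close> carries weight
      \<open>1/2\<close>, and \<open>visit\<close> is applied to its image under
      \<open>k\<close>.\<close>
    have "d\<^sup>2 / 2 \<le> (\<Sum>g\<in>F. dense_form (\<rho> (k \<otimes> g) f))" if k: "k \<in> K n" for k
    proof -
      have iso: "\<rho> k \<in> Iso_C" using Act_topD(1)[OF \<rho> Kc[OF k]] .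
      obtain g where g: "g \<in> F" "d \<le> \<bar>\<rho> g f (iso_point (\<rho> k) (dense_point 0))\<bar>"
        using visit by blast
      then have "d \<le> \<bar>\<rho> (k \<otimes> g) f (dense_point 0)\<bar>"
        using F(2) Kc[OF k] Act_topD(2)[OF \<rho>, of k g f] iso
        by (auto simp: banach_stone[OF iso] abs_mult)
      then have "d\<^sup>2 \<le> (\<rho> (k \<otimes> g) f (dense_point 0))\<^sup>2"
        using d(1) by (metis abs_of_pos abs_le_square_iff)
      then have "d\<^sup>2 / 2 \<le> dense_form (\<rho> (k \<otimes> g) f)"
        using dense_form_ge[of 0 "\<rho> (k \<otimes> g) f"] by simp
      also have "\<dots> \<le> (\<Sum>g\<in>F. dense_form (\<rho> (k \<otimes> g) f))"
        by (rule member_le_sum[of g F "\<lambda>g. dense_form (\<rho> (k \<otimes> g) f)"])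
           (use g F dense_form_nonneg in auto)
      finally show ?thesis .
    qed
    then have "card (K n) * (d\<^sup>2 / 2) \<le> (\<Sum>k\<in>K n. \<Sum>g\<in>F. dense_form (\<rho> (k \<otimes> g) f))"
      by (rule sum_bounded_below)
    also have "\<dots> = (\<Sum>g\<in>F. \<Sum>k\<in>K n. dense_form (\<rho> (k \<otimes> g) f))" by (rule sum.swap)
    also have "\<dots> = (\<Sum>g\<in>F. \<Sum>k\<in>K n. dense_form (\<rho> k f))"
      using m[OF n] by (intro sum.cong refl sum_subgroup_right_translate[OF K(1)]) auto
    also have "\<dots> = card F * (\<Sum>k\<in>K n. dense_form (\<rho> k f))" by simp
    finally show ?thesis using cF cK by (simp add: form_avg_def field_simps)
  qed
  then show ?thesis using d(1) cF by (intro exI[of _ "d\<^sup>2 / (2 * card F)"]) auto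
qed

text \<open>The chain is eventually the whole group, and one average of positive numbers is
  positive.\<close>

lemma (in group) finite_imp_form_avg_ge:
  assumes \<rho>: "\<rho> \<in> topspace (Act_top G)" and fin: "finite (carrier G)"
    and K: "\<And>n. subgroup (K n) G" "\<And>n. K n \<subseteq> K (Suc n)" "(\<Union>n. K n) = carrier G"
    and f: "f \<noteq> 0"
  shows "\<exists>c>0. \<exists>m. \<forall>n\<ge>m. c \<le> form_avg \<rho> (K n) f"
proof -
  obtain m where m: "\<And>n. n \<ge> m \<Longrightarrow> carrier G \<subseteq> K n"
    using finite_subset_chain[of K "carrier G"] K fin by auto
  then have eq: "K n = carrier G" if "n \<ge> m" for n
    using that K(3) by blast
  have "0 < dense_form (\<rho> g f)" if "g \<in> carrier G" for g
  proof (rule dense_form_pos)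
    show "\<rho> g f \<noteq> 0" using Iso_CD(4,7)[OF Act_topD(1)[OF \<rho> that]] f by metis
  qed
  then have "0 < form_avg \<rho> (carrier G) f"
    unfolding form_avg_def using fin
    by (intro divide_pos_pos sum_pos) (auto simp: card_gt_0_iff)
  then show ?thesis
    using eq by (intro exI[of _ "form_avg \<rho> (carrier G) f"] conjI exI[of _ m]) auto
qed

section \<open>Open conditions and limits in the space of actions\<close>

lemma continuous_map_Act_top_eval:
  assumes "g \<in> carrier G"
  shows "continuous_map (Act_top G) euclidean (\<lambda>\<rho>. \<rho> g f)"
proof -
  have "continuous_map (Act_top G) SOT_Iso (\<lambda>\<rho>. \<rho> g)"
    unfolding Act_top_def
    by (intro continuous_map_from_subtopology continuous_map_product_projection assms)
  moreover have "continuous_map SOT_Iso euclidean (\<lambda>T. T f)"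
    unfolding SOT_Iso_def
    by (intro continuous_map_from_subtopology continuous_map_product_projection) simp
  ultimately show ?thesis using continuous_map_compose by (fastforce simp: o_def)
qed

lemma limitin_Act_top:
  assumes "\<rho> \<in> topspace (Act_top G)" "\<And>n. \<sigma> n \<in> topspace (Act_top G)"
    and lim: "\<And>g f. g \<in> carrier G \<Longrightarrow> (\<lambda>n. \<sigma> n g f) \<longlonglongrightarrow> \<rho> g f"
  shows "limitin (Act_top G) \<sigma> \<rho> sequentially"
proof -
  have "limitin SOT_Iso (\<lambda>n. \<sigma> n g) (\<rho> g) sequentially" if "g \<in> carrier G" for g
    using that assms Act_topD(1)[OF assms(1) that] Act_topD(1)[OF assms(2) that]
    by (simp add: SOT_Iso_def limitin_subtopology limitin_componentwise)
  then show ?thesis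
    using assms(1,2) unfolding Act_top_def
    by (auto simp: limitin_subtopology limitin_componentwise PiE_def)
qed

text \<open>The same \<open>F\<close> works for nearby actions: the nonzero values of
  \<open>\<rho> g (cylinder w)\<close> have modulus one, so a perturbation of sup norm below one at
  the finitely many \<open>g\<close> in \<open>F\<close> cannot cancel them.\<close>

lemma openin_syndetic:
  "openin (Act_top G) {\<rho> \<in> topspace (Act_top G). syndetic_on G \<rho> w}" (is "openin _ ?O")
proof (subst openin_subopen, intro ballI)
  fix \<rho> assume "\<rho> \<in> ?O"
  then obtain F where \<rho>: "\<rho> \<in> topspace (Act_top G)" and F: "finite F" "F \<subseteq> carrier G"
      "\<And>x. \<exists>g\<in>F. \<rho> g (cylinder w) x \<noteq> 0"
    unfolding syndetic_on_def by blast
  let ?B = "\<lambda>g. {\<sigma> \<in> topspace (Act_top G). \<sigma> g (cylinder w) \<in> ball (\<rho> g (cylinder w)) 1}"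
  have ne: "F \<noteq> {}" using F(3) by blast
  have "openin (Act_top G) (\<Inter>g\<in>F. ?B g)"
    using F by (intro openin_INT2 ne openin_continuous_map_preimage[where Y = euclidean]
        continuous_map_Act_top_eval) auto
  moreover have "(\<Inter>g\<in>F. ?B g) \<subseteq> ?O"
  proof
    fix \<sigma> assume \<sigma>: "\<sigma> \<in> (\<Inter>g\<in>F. ?B g)"
    have "\<exists>g\<in>F. \<sigma> g (cylinder w) x \<noteq> 0" for x
    proof -
      obtain g where g: "g \<in> F" "\<rho> g (cylinder w) x \<noteq> 0" using F(3) by blast
      then have iso: "\<rho> g \<in> Iso_C" using F(2) Act_topD(1)[OF \<rho>] by blast
      have "\<bar>\<rho> g (cylinder w) x\<bar> = 1"
        using g(2) iso by (simp add: banach_stone[OF iso] abs_mult split: if_splits)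
      moreover have "dist (\<rho> g (cylinder w)) (\<sigma> g (cylinder w)) < 1" using \<sigma> g by auto
      then have "dist (\<rho> g (cylinder w) x) (\<sigma> g (cylinder w) x) < 1"
        by (rule dist_fun_lt_imp_dist_val_lt)
      ultimately have "\<sigma> g (cylinder w) x \<noteq> 0" by (auto simp: dist_real_def)
      then show ?thesis using g(1) by blast
    qed
    then show "\<sigma> \<in> ?O" using \<sigma> ne F(1,2) by (auto simp: syndetic_on_def)
  qed
  ultimately show "\<exists>T. openin (Act_top G) T \<and> \<rho> \<in> T \<and> T \<subseteq> ?O"
    using \<rho> by (intro exI[of _ "\<Inter>g\<in>F. ?B g"]) auto
qed

text \<open>The complement of \<open>U\<close> is closed, and an open set inside it would catch the
  tail of a sequence from \<open>U\<close>.\<close>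

lemma nowhere_dense_in_compl_open:
  assumes "openin X U" and "\<And>x. x \<in> topspace X \<Longrightarrow> \<exists>s. limitin X s x sequentially \<and> (\<forall>n::nat. s n \<in> U)"
  shows "nowhere_dense_in X (topspace X - U)"
proof -
  have "X closure_of (topspace X - U) = topspace X - U"
    using assms(1) by (simp add: closure_of_closedin closedin_diff)
  moreover have "V = {}" if V: "openin X V" "V \<subseteq> topspace X - U" for V
  proof (rule ccontr)
    assume "V \<noteq> {}"
    then obtain x where x: "x \<in> V" by blast
    then obtain s where s: "limitin X s x sequentially" "\<And>n. s n \<in> U"
      using assms(2)[of x] openin_subset[OF V(1)] by blast
    then have "\<forall>\<^sub>F n in sequentially. s n \<in> V" using V x by (auto simp: limitin_def)
    then obtain n where "s n \<in> V" by (metis eventually_happens sequentially_bot)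
    then show False using s(2) V(2) by blast
  qed
  ultimately show ?thesis
    unfolding nowhere_dense_in_def by (metis openin_interior_of interior_of_subset)
qed

section \<open>Equivariant codings\<close>

lemma exists_onto:
  assumes "finite A" "B \<noteq> {}" "card B \<le> card A" "finite B"
  shows "\<exists>f. f ` A = B"
proof -
  obtain g where g: "g ` B \<subseteq> A" "inj_on g B" using card_le_inj[OF assms(4,1,3)] by blast
  obtain b where b: "b \<in> B" using assms(2) by blast
  have "(\<lambda>a. if a \<in> g ` B then inv_into B g a else b) ` A = B"
  proof (intro equalityI subsetI)
    fix y assume "y \<in> B"
    then show "y \<in> (\<lambda>a. if a \<in> g ` B then inv_into B g a else b) ` A"
      using g by (intro image_eqI[of _ _ "g y"]) auto
  qed (use b inv_into_into[of _ g B] in \<open>auto split: if_splits\<close>)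
  then show ?thesis by blast
qed

text \<open>The Cantor space is perfect, so a cylinder splits into any prescribed finite number of
  nonempty clopen pieces.\<close>

lemma finitely_determined_onto_cylinder:
  assumes "finite Q" "Q \<noteq> {}"
  shows "\<exists>\<beta>. finitely_determined \<beta> \<and> range \<beta> \<subseteq> Q \<and> \<beta> ` {y. agree N x y} = Q"
proof -
  define m where "m = card Q"
  obtain q where q: "bij_betw q {..<m} Q"
    using ex_bij_betw_nat_finite[OF assms(1)] by (auto simp: m_def atLeast0LessThan)
  have m: "m > 0" using assms by (simp add: m_def card_gt_0_iff)
  \<comment> \<open>The offset of the first true entry in the window of length \<open>m\<close>
    after position \<open>N\<close>. The default 0 is a legal index because
    \<open>m > 0\<close>.\<close>
  define J where "J l = (if \<exists>j<m. l ! (N + j) then LEAST j. l ! (N + j) else 0)" for l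
  define \<beta> where "\<beta> y = q (J (map y [0..<N + m]))" for y
  have J: "J l < m" for l
    using m by (auto simp: J_def intro: le_less_trans[OF Least_le])
  have "finitely_determined \<beta>"
    by (rule finitely_determinedI[where N = "N + m"]) (simp only: \<beta>_def agree_iff_map_upt)
  moreover have sub: "range \<beta> \<subseteq> Q" using J q by (auto simp: \<beta>_def bij_betw_def)
  moreover have "\<beta> ` {y. agree N x y} = Q"
  proof
    show "\<beta> ` {y. agree N x y} \<subseteq> Q" using sub by auto
    show "Q \<subseteq> \<beta> ` {y. agree N x y}"
    proof
      fix a assume "a \<in> Q"
      then obtain j where j: "j < m" "a = q j" using q by (auto simp: bij_betw_def)
      \<comment> \<open>A point of the cylinder whose window has its only true entry at offset
        \<open>j\<close>.\<close>
      let ?y = "\<lambda>i. if i < N then x i else i = N + j"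
      have l: "map ?y [0..<N + m] ! (N + i) \<longleftrightarrow> i = j" if "i < m" for i
        using that by simp
      have "(LEAST i. map ?y [0..<N + m] ! (N + i)) = j"
      proof (rule Least_equality)
        show "map ?y [0..<N + m] ! (N + j)" using l j by blast
        show "j \<le> i" if "map ?y [0..<N + m] ! (N + i)" for i
          using l[of i] that j by (cases "i < m") auto
      qed
      then have "J (map ?y [0..<N + m]) = j" using l j unfolding J_def by auto
      then have "\<beta> ?y = a" by (simp only: \<beta>_def j)
      moreover have "agree N x ?y" by (simp add: agree_def)
      ultimately show "a \<in> \<beta> ` {y. agree N x y}" by blast
    qed
  qed
  ultimately show ?thesis by blast
qed

text \<open>Each piece of the partition \<open>\<kappa>\<close> is split into nonempty clopen parts
  labelled by the fibre of \<open>\<pi>\<close> over its label.\<close>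

lemma finitely_determined_lift:
  assumes \<kappa>: "finitely_determined \<kappa>" and Q: "finite Q" and \<pi>: "\<pi> ` Q = range \<kappa>"
  shows "\<exists>\<alpha>. finitely_determined \<alpha> \<and> range \<alpha> = Q \<and> (\<forall>x. \<pi> (\<alpha> x) = \<kappa> x)"
proof -
  obtain N where N: "\<And>x y. agree N x y \<Longrightarrow> \<kappa> x = \<kappa> y"
    using \<kappa> unfolding finitely_determined_def by blast
  \<comment> \<open>The cylinder of depth \<open>N\<close> at \<open>c p\<close> lies inside the
    piece labelled \<open>p\<close>, so labels that occur on this cylinder occur on the
    piece.\<close>
  define c where "c p = (SOME x. \<kappa> x = p)" for p
  have c: "\<kappa> (c p) = p" if "p \<in> range \<kappa>" for p
    using that unfolding c_def by (metis (mono_tags, lifting) imageE someI)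
  let ?Q = "\<lambda>p. {k \<in> Q. \<pi> k = p}"
  have "\<forall>p\<in>range \<kappa>. \<exists>\<beta>. finitely_determined \<beta> \<and> range \<beta> \<subseteq> ?Q p \<and> \<beta> ` {y. agree N (c p) y} = ?Q p"
  proof (intro ballI finitely_determined_onto_cylinder)
    fix p assume "p \<in> range \<kappa>"
    then obtain k where "k \<in> Q" "p = \<pi> k" using \<pi> by blast
    then show "?Q p \<noteq> {}" by blast
  qed (use Q in simp)
  from bchoice[OF this] obtain \<beta> where \<beta>: "\<And>p. p \<in> range \<kappa> \<Longrightarrow> finitely_determined (\<beta> p)"
    "\<And>p. p \<in> range \<kappa> \<Longrightarrow> range (\<beta> p) \<subseteq> ?Q p"
    "\<And>p. p \<in> range \<kappa> \<Longrightarrow> \<beta> p ` {y. agree N (c p) y} = ?Q p" by blast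
  define \<alpha> where "\<alpha> x = \<beta> (\<kappa> x) x" for x
  \<comment> \<open>All the finitely many splittings are recorded at once; \<open>\<alpha>\<close>
    then selects the one belonging to the piece of \<open>x\<close>.\<close>
  have "finitely_determined (\<lambda>x. (\<kappa> x, restrict (\<lambda>p. \<beta> p x) (range \<kappa>)))"
    by (intro finitely_determined_Pair finitely_determined_restrict \<kappa>
          finitely_determined_imp_finite_range \<beta>(1))
  from finitely_determined_comp[OF this, of "\<lambda>(p, b). b p"]
  have "finitely_determined \<alpha>" by (simp add: \<alpha>_def[abs_def])
  moreover have in_Q: "\<alpha> x \<in> Q \<and> \<pi> (\<alpha> x) = \<kappa> x" for x
    using \<beta>(2)[of "\<kappa> x"] by (auto simp: \<alpha>_def)
  moreover have "Q \<subseteq> range \<alpha>"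
  proof
    fix k assume k: "k \<in> Q"
    then have p: "\<pi> k \<in> range \<kappa>" using \<pi> by blast
    then have "k \<in> \<beta> (\<pi> k) ` {y. agree N (c (\<pi> k)) y}" using \<beta>(3) k by simp
    then obtain y where y: "agree N (c (\<pi> k)) y" "k = \<beta> (\<pi> k) y" by blast
    then have "\<alpha> y = k" using N[OF y(1)] c[OF p] by (simp add: \<alpha>_def)
    then show "k \<in> range \<alpha>" by blast
  qed
  ultimately show ?thesis by blast
qed

section \<open>Transversals and refinement of codings\<close>

text \<open>Every \<open>k\<close> factors as \<open>r k \<otimes> q k\<close>, so \<open>K\<close>
  is \<open>R\<close> times \<open>H\<close> as a right \<open>H\<close>-set. Maps out of
  \<open>K\<close> that respect \<open>H\<close> can thus be prescribed freely on
  \<open>R\<close>.\<close>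

lemma (in group) left_transversal:
  assumes K: "subgroup K G" "finite K" and H: "subgroup H G" "H \<subseteq> K"
  shows "\<exists>R q r. finite R \<and> card K \<le> card R * card H \<and> (\<forall>k\<in>K. q k \<in> H \<and> r k \<in> R) \<and>
    (\<forall>k\<in>K. \<forall>h\<in>H. q (k \<otimes> h) = q k \<otimes> h \<and> r (k \<otimes> h) = r k) \<and>
    (\<forall>t\<in>R. \<forall>h\<in>H. t \<otimes> h \<in> K \<and> q (t \<otimes> h) = h \<and> r (t \<otimes> h) = t)"
proof -
  note [simp] = subgroup.m_closed[OF K(1)] subgroup.m_inv_closed[OF K(1)]
    subgroup.m_closed[OF H(1)] subgroup.m_inv_closed[OF H(1)] subgroup.one_closed[OF H(1)]
  have [simp]: "k \<in> carrier G" if "k \<in> K" for k using subgroup.mem_carrier[OF K(1) that] .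
  have [simp]: "h \<in> K" if "h \<in> H" for h using H that by blast
  \<comment> \<open>The choice depends only on the coset of \<open>k\<close>, because the
    chosen-from predicate is the same for \<open>k\<close> and \<open>k \<otimes> h\<close>.\<close>
  define r where "r k = (SOME t. t \<in> K \<and> inv t \<otimes> k \<in> H)" for k
  define q where "q k = inv (r k) \<otimes> k" for k
  have r: "r k \<in> K \<and> q k \<in> H" if "k \<in> K" for k
    unfolding r_def q_def by (rule someI[of _ k]) (use that in simp)
  have r_mult: "r (k \<otimes> h) = r k" if kh: "k \<in> K" "h \<in> H" for k h
  proof -
    have "inv t \<otimes> (k \<otimes> h) \<in> H \<longleftrightarrow> inv t \<otimes> k \<in> H" if t: "t \<in> K" for t
    proof
      assume "inv t \<otimes> (k \<otimes> h) \<in> H"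
      then have "inv t \<otimes> (k \<otimes> h) \<otimes> inv h \<in> H" using kh by simp
      then show "inv t \<otimes> k \<in> H" using kh t by (simp add: m_assoc)
    next
      assume "inv t \<otimes> k \<in> H"
      then have "inv t \<otimes> k \<otimes> h \<in> H" using kh by simp
      then show "inv t \<otimes> (k \<otimes> h) \<in> H" using kh t by (simp add: m_assoc)
    qed
    then show ?thesis unfolding r_def by metis
  qed
  have k_eq: "r k \<otimes> q k = k" if "k \<in> K" for k
    using that r[OF that] by (simp add: q_def flip: m_assoc)
  have rr: "r (r k) = r k" if "k \<in> K" for k
    using r_mult[of "r k" "q k"] k_eq[OF that] r[OF that] by simp
  show ?thesis
  proof (rule exI[of _ "r ` K"], rule exI[of _ q], rule exI[of _ r], intro conjI ballI)
    show "finite (r ` K)" using K(2) by simp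
    have "inj_on (\<lambda>k. (r k, q k)) K"
      by (rule inj_onI) (metis k_eq prod.inject)
    then have "card K = card ((\<lambda>k. (r k, q k)) ` K)" by (simp add: card_image)
    also have "\<dots> \<le> card (r ` K \<times> H)"
      using r K H(2) by (intro card_mono finite_cartesian_product finite_imageI)
        (auto intro: finite_subset)
    finally show "card K \<le> card (r ` K) * card H" by (simp add: card_cartesian_product)
    show "q k \<in> H" "r k \<in> r ` K" if "k \<in> K" for k using r that by auto
    show "q (k \<otimes> h) = q k \<otimes> h" "r (k \<otimes> h) = r k" if "k \<in> K" "h \<in> H" for k h
      using r_mult[OF that] r[OF that(1)] that by (simp_all add: q_def m_assoc)
    show "t \<otimes> h \<in> K" "q (t \<otimes> h) = h" "r (t \<otimes> h) = t" if t: "t \<in> r ` K" and h: "h \<in> H" for t h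
    proof -
      have tK: "t \<in> K" and tr: "r t = t" using t r rr by auto
      then show "r (t \<otimes> h) = t" using r_mult[OF tK h] by simp
      then show "t \<otimes> h \<in> K" "q (t \<otimes> h) = h"
        using tK h by (simp_all add: q_def flip: m_assoc)
    qed
  qed
qed

lemma (in group) large_finite_subgroup:
  assumes "infinite (carrier G)" "locally_finite_group G" "finite S" "S \<subseteq> carrier G"
  obtains K where "subgroup K G" "finite K" "S \<subseteq> K" "m \<le> card K"
proof -
  obtain T where T: "finite T" "card T = m" "T \<subseteq> carrier G"
    using infinite_arbitrarily_large[OF assms(1)] by blast
  have ST: "S \<union> T \<subseteq> carrier G" "finite (S \<union> T)" using T assms by auto
  have incl: "S \<union> T \<subseteq> generate G (S \<union> T)" by (auto intro: generate.incl)
  show ?thesis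
  proof
    show "subgroup (generate G (S \<union> T)) G" by (rule generate_is_subgroup[OF ST(1)])
    show fin: "finite (generate G (S \<union> T))"
      using assms(2) ST unfolding locally_finite_group_def by blast
    show "S \<subseteq> generate G (S \<union> T)" using incl by blast
    show "m \<le> card (generate G (S \<union> T))"
      using card_mono[OF fin, of T] incl T by auto
  qed
qed

text \<open>One storey of the tower. The pair of old code and prefix of length \<open>n\<close> is
  lifted to a coding by a larger group \<open>K\<close>; since \<open>q\<close> commutes with right
  multiplication by \<open>H\<close>, so does the projection from new codes to old ones.\<close>

lemma (in group) refine_coding:
  assumes inf: "infinite (carrier G)" and lf: "locally_finite_group G"
    and H: "subgroup H G" "finite H" and g: "g \<in> carrier G"
    and \<alpha>: "finitely_determined \<alpha>" "range \<alpha> = H"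
  shows "\<exists>K \<alpha>'. subgroup K G \<and> finite K \<and> finitely_determined \<alpha>' \<and> range \<alpha>' = K \<and>
    H \<subseteq> K \<and> g \<in> K \<and> (\<forall>x y. \<alpha>' x = \<alpha>' y \<longrightarrow> agree n x y) \<and>
    (\<forall>x y. \<forall>h\<in>H. \<alpha>' y = \<alpha>' x \<otimes> h \<longrightarrow> \<alpha> y = \<alpha> x \<otimes> h)"
proof -
  have Hc: "insert g H \<subseteq> carrier G" "finite (insert g H)"
    using subgroup.subset[OF H(1)] g H by auto
  \<comment> \<open>This size provides at least as many cosets of \<open>H\<close> as there are
    words of length \<open>n\<close>.\<close>
  obtain K where K: "subgroup K G" "finite K" "insert g H \<subseteq> K" "2 ^ n * card H \<le> card K"
    using large_finite_subgroup[OF inf lf Hc(2,1)] by metis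
  obtain R q r where R: "finite R" "card K \<le> card R * card H"
    and qr: "\<forall>k\<in>K. q k \<in> H \<and> r k \<in> R"
    and qm: "\<forall>k\<in>K. \<forall>h\<in>H. q (k \<otimes> h) = q k \<otimes> h \<and> r (k \<otimes> h) = r k"
    and tm: "\<forall>t\<in>R. \<forall>h\<in>H. t \<otimes> h \<in> K \<and> q (t \<otimes> h) = h \<and> r (t \<otimes> h) = t"
    using left_transversal[OF K(1,2) H(1)] K(3) by auto
  note q = qr[rule_format, THEN conjunct1] and r = qr[rule_format, THEN conjunct2]
  note qm = qm[rule_format] and tm = tm[rule_format]
  have "card H > 0" using H(2) subgroup.one_closed[OF H(1)] by (metis card_gt_0_iff empty_iff)
  moreover have "2 ^ n * card H \<le> card R * card H" using K(4) R(2) by linarith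
  ultimately have cR: "2 ^ n \<le> card R" by simp
  define \<kappa> where "\<kappa> x = (\<alpha> x, map x [0..<n])" for x :: "nat \<Rightarrow> bool"
  have \<kappa>: "finitely_determined \<kappa>"
    unfolding \<kappa>_def
    by (intro finitely_determined_Pair \<alpha>(1) finitely_determinedI[where N = n])
       (simp only: agree_iff_map_upt)
  \<comment> \<open>The prefixes that occur in the piece coded \<open>h\<close>; the cosets are
    distributed onto them.\<close>
  define W where "W h = {w. (h, w) \<in> range \<kappa>}" for h
  have W: "\<exists>j. j ` R = W h" if "h \<in> H" for h
  proof (rule exists_onto[OF R(1)])
    show "W h \<noteq> {}" using that \<alpha>(2) by (force simp: W_def \<kappa>_def)
    have "W h \<subseteq> {w. set w \<subseteq> (UNIV :: bool set) \<and> length w = n}" by (auto simp: W_def \<kappa>_def)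
    moreover have "finite {w. set w \<subseteq> (UNIV :: bool set) \<and> length w = n}"
      by (rule finite_lists_length_eq) simp
    moreover have "card {w. set w \<subseteq> (UNIV :: bool set) \<and> length w = n} = 2 ^ n"
      by (subst card_lists_length_eq) auto
    ultimately show "finite (W h)" "card (W h) \<le> card R"
      using cR by (auto dest: finite_subset card_mono)
  qed
  then have "\<forall>h\<in>H. \<exists>j. j ` R = W h" by blast
  from bchoice[OF this] obtain j where "\<forall>h\<in>H. j h ` R = W h" ..
  note j = this[rule_format]
  \<comment> \<open>Only the first component must respect \<open>H\<close>. The second is any
    surjection onto the prefixes, as these need only be determined by the new code.\<close>
  define \<pi> where "\<pi> k = (q k, j (q k) (r k))" for k
  have "\<pi> ` K = range \<kappa>"
  proof (intro equalityI subsetI)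
    fix p assume "p \<in> \<pi> ` K"
    then obtain k where k: "k \<in> K" "p = \<pi> k" by blast
    then have "j (q k) (r k) \<in> W (q k)" using j q r by blast
    then show "p \<in> range \<kappa>" by (simp add: W_def \<pi>_def k)
  next
    fix p assume p: "p \<in> range \<kappa>"
    then obtain h w where hw: "p = (h, w)" "h \<in> H" "w \<in> W h"
      using \<alpha>(2) by (auto simp: W_def \<kappa>_def)
    then obtain t where t: "t \<in> R" "w = j h t" using j by blast
    then have "\<pi> (t \<otimes> h) = p" "t \<otimes> h \<in> K" using tm[OF t(1) hw(2)] by (simp_all add: \<pi>_def hw)
    then show "p \<in> \<pi> ` K" by blast
  qed
  from finitely_determined_lift[OF \<kappa> K(2) this]
  obtain \<alpha>' where \<alpha>': "finitely_determined \<alpha>'" "range \<alpha>' = K" "\<And>x. \<pi> (\<alpha>' x) = \<kappa> x" by blast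
  have det: "agree n x y" if "\<alpha>' x = \<alpha>' y" for x y
  proof -
    have "\<kappa> x = \<kappa> y" using \<alpha>'(3) that by metis
    then show ?thesis by (simp only: \<kappa>_def prod.inject agree_iff_map_upt)
  qed
  have equiv: "\<alpha> y = \<alpha> x \<otimes> h" if h: "h \<in> H" "\<alpha>' y = \<alpha>' x \<otimes> h" for x y h
  proof -
    have "q (\<alpha>' z) = \<alpha> z" for z using \<alpha>'(3)[of z] by (simp add: \<pi>_def \<kappa>_def)
    moreover have "\<alpha>' x \<in> K" using \<alpha>'(2) by blast
    ultimately show ?thesis using qm[of "\<alpha>' x" h] h by metis
  qed
  show ?thesis
    by (rule exI[of _ K], rule exI[of _ \<alpha>'], intro conjI) (use K \<alpha>' det equiv in blast)+
qed

section \<open>Coding a given action at a finite scale\<close>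

lemma finitely_determined_cantor_C:
  fixes f :: cantor_C
  assumes "\<And>x. f x \<in> {-1, 0, 1}"
  shows "finitely_determined (apply_bcontfun f)"
proof -
  obtain N where N: "\<And>x y. agree N x y \<Longrightarrow> \<bar>f x - f y\<bar> < 1"
    using cantor_C_uniform[of 1 f] by (metis zero_less_one)
  show ?thesis
  proof (rule finitely_determinedI)
    fix x y assume "agree N x y"
    from N[OF this] show "f x = f y" using assms[of x] assms[of y] by auto
  qed
qed

lemma finitely_determined_iso_sign:
  assumes "T \<in> Iso_C" shows "finitely_determined (iso_sign T)"
proof -
  have "finitely_determined (apply_bcontfun (T (const_bcontfun 1)))"
  proof (rule finitely_determined_cantor_C)
    fix x show "T (const_bcontfun 1) x \<in> {-1, 0, 1}"
      using abs_iso_sign[OF assms, of x] by (auto simp: iso_sign_def abs_if split: if_splits)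
  qed
  then show ?thesis by (simp add: iso_sign_def[abs_def])
qed

lemma finitely_determined_iso_point:
  assumes "T \<in> Iso_C" shows "finitely_determined (\<lambda>x. map (iso_point T x) [0..<n])"
proof -
  have "finitely_determined (\<lambda>x. iso_point T x i)" for i
  proof -
    have "finitely_determined (apply_bcontfun (T (coord i)))"
    proof (rule finitely_determined_cantor_C)
      fix x show "T (coord i) x \<in> {-1, 0, 1}"
        using abs_iso_sign[OF assms, of x]
        by (auto simp: banach_stone[OF assms] abs_if split: if_splits)
    qed
    from finitely_determined_comp[OF this, of "\<lambda>v. v \<noteq> 0"] show ?thesis
      by (simp add: iso_point_def)
  qed
  then have "finitely_determined (\<lambda>x. restrict (iso_point T x) {0..<n})"
    by (intro finitely_determined_restrict) auto
  from finitely_determined_comp[OF this, of "\<lambda>u. map u [0..<n]"]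
  have "finitely_determined (\<lambda>x. map (restrict (iso_point T x) {0..<n}) [0..<n])" .
  moreover have "map (restrict (iso_point T x) {0..<n}) [0..<n] = map (iso_point T x) [0..<n]" for x
    by simp
  ultimately show ?thesis by (simp only:)
qed

lemma (in group) Act_top_one:
  assumes "\<rho> \<in> topspace (Act_top G)" shows "\<rho> \<one> f = f"
  using Act_topD(2)[OF assms, of \<one> \<one> f] Iso_CD(7)[OF Act_topD(1)[OF assms, of \<one>]] by simp

text \<open>Operators compose from the left, hence points move by a right action, which is why codes
  are later multiplied on the right. The signs form a cocycle over it.\<close>

lemma (in group)
  assumes \<rho>: "\<rho> \<in> topspace (Act_top G)" and gh: "g \<in> carrier G" "h \<in> carrier G"
  shows iso_sign_cocycle:
      "iso_sign (\<rho> (g \<otimes> h)) x = iso_sign (\<rho> g) x * iso_sign (\<rho> h) (iso_point (\<rho> g) x)"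
    and iso_point_action: "iso_point (\<rho> (g \<otimes> h)) x = iso_point (\<rho> h) (iso_point (\<rho> g) x)"
proof -
  have iso: "\<rho> g \<in> Iso_C" using Act_topD(1)[OF \<rho> gh(1)] .
  have *: "\<rho> (g \<otimes> h) f x = iso_sign (\<rho> g) x * \<rho> h f (iso_point (\<rho> g) x)" for f
    by (simp add: Act_topD(2)[OF \<rho> gh] banach_stone[OF iso, of "\<rho> h f"])
  show "iso_sign (\<rho> (g \<otimes> h)) x = iso_sign (\<rho> g) x * iso_sign (\<rho> h) (iso_point (\<rho> g) x)"
    using *[of "const_bcontfun 1"] by (simp add: iso_sign_def)
  have "iso_sign (\<rho> g) x \<noteq> 0" using abs_iso_sign[OF iso, of x] by auto
  then show "iso_point (\<rho> (g \<otimes> h)) x = iso_point (\<rho> h) (iso_point (\<rho> g) x)"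
    using * by (simp add: iso_point_def)
qed

lemma (in group) iso_point_one:
  assumes "\<rho> \<in> topspace (Act_top G)" shows "iso_point (\<rho> \<one>) x = x"
  by (simp add: iso_point_def Act_top_one[OF assms])

text \<open>At scale \<open>n\<close> the subgroup \<open>H\<close> permutes finitely many codes
  with signs. Replacing the codes by the free right \<open>H\<close>-set \<open>K\<close> turns the
  sign cocycle into a coboundary, given by \<open>s\<close>, which is what lets the signs extend to
  an action of the whole group.\<close>

lemma (in group) initial_coding:
  assumes inf: "infinite (carrier G)" and lf: "locally_finite_group G"
    and \<rho>: "\<rho> \<in> topspace (Act_top G)" and H: "subgroup H G" "finite H"
  shows "\<exists>K \<alpha> s. subgroup K G \<and> finite K \<and> H \<subseteq> K \<and> finitely_determined \<alpha> \<and> range \<alpha> = K \<and>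
    (\<forall>k\<in>K. \<bar>s k :: real\<bar> = 1) \<and>
    (\<forall>h\<in>H. \<forall>x y. \<alpha> y = \<alpha> x \<otimes> h \<longrightarrow>
      s (\<alpha> x) * s (\<alpha> y) = iso_sign (\<rho> h) x \<and> agree n y (iso_point (\<rho> h) x))"
proof -
  have Hc [simp]: "h \<in> carrier G" if "h \<in> H" for h using subgroup.mem_carrier[OF H(1) that] .
  note [simp] = subgroup.m_closed[OF H(1)] subgroup.one_closed[OF H(1)]
  have iso [simp]: "\<rho> h \<in> Iso_C" if "h \<in> H" for h using Act_topD(1)[OF \<rho> Hc[OF that]] .
  \<comment> \<open>Signs and prefixes along the whole \<open>H\<close>-orbit are recorded, so that
    the code of \<open>x\<close> determines the code of each of its translates.\<close>
  define code where "code x = restrict (\<lambda>h. (iso_sign (\<rho> h) x, map (iso_point (\<rho> h) x) [0..<n])) H" for x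
  have code: "finitely_determined code"
    unfolding code_def
    by (intro finitely_determined_restrict H finitely_determined_Pair finitely_determined_iso_sign
        finitely_determined_iso_point iso)
  \<comment> \<open>The cocycle identity solved for the sign of \<open>h'\<close> at the translate
    of \<open>x\<close> by \<open>h\<close>; a sign is its own inverse.\<close>
  define act where "act p h = restrict (\<lambda>h'. (fst (p h) * fst (p (h \<otimes> h')), snd (p (h \<otimes> h')))) H"
    for p :: "'a \<Rightarrow> real \<times> bool list" and h
  have act: "code (iso_point (\<rho> h) x) = act (code x) h" if h: "h \<in> H" for h x
  proof (rule ext)
    fix h'
    have "iso_sign (\<rho> h') (iso_point (\<rho> h) x) = iso_sign (\<rho> h) x * iso_sign (\<rho> (h \<otimes> h')) x" if "h' \<in> H"
      using iso_sign_cocycle[OF \<rho>, of h h' x] iso_sign_square[OF iso[OF h], of x] h that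
      by (simp flip: mult.assoc)
    then show "code (iso_point (\<rho> h) x) h' = act (code x) h h'"
      using h by (simp add: code_def act_def iso_point_action[OF \<rho>] restrict_def)
  qed
  define P where "P = range code"
  have P: "finite P" "P \<noteq> {}"
    using finitely_determined_imp_finite_range[OF code] by (auto simp: P_def)
  have HG: "H \<subseteq> carrier G" using Hc by blast
  obtain K where K: "subgroup K G" "finite K" "H \<subseteq> K" "card P * card H \<le> card K"
    using large_finite_subgroup[OF inf lf H(2) HG] by metis
  obtain R q r where R: "finite R" "card K \<le> card R * card H"
    and qr: "\<forall>k\<in>K. q k \<in> H \<and> r k \<in> R"
    and qm: "\<forall>k\<in>K. \<forall>h\<in>H. q (k \<otimes> h) = q k \<otimes> h \<and> r (k \<otimes> h) = r k"
    and tm: "\<forall>t\<in>R. \<forall>h\<in>H. t \<otimes> h \<in> K \<and> q (t \<otimes> h) = h \<and> r (t \<otimes> h) = t"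
    using left_transversal[OF K(1,2) H(1) K(3)] by auto
  note q = qr[rule_format, THEN conjunct1] and r = qr[rule_format, THEN conjunct2]
  note qm = qm[rule_format] and tm = tm[rule_format]
  have "card H > 0" using H(2) subgroup.one_closed[OF H(1)] by (metis card_gt_0_iff empty_iff)
  moreover have "card P * card H \<le> card R * card H" using K(4) R(2) by linarith
  ultimately have cR: "card P \<le> card R" by simp
  obtain i where i: "i ` R = P" using exists_onto[OF R(1) P(2) cR P(1)] by blast
  have "\<exists>z. code z = i (r k)" if "k \<in> K" for k
  proof -
    have "i (r k) \<in> range code" using i r[OF that] unfolding P_def by blast
    then show ?thesis by (metis imageE)
  qed
  then obtain z where z: "\<And>k. k \<in> K \<Longrightarrow> code (z k) = i (r k)" by metis
  \<comment> \<open>The code \<open>i (r k)\<close> is prescribed on each coset of \<open>H\<close>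
    and moved along the coset by \<open>q k\<close>.\<close>
  define \<pi> where "\<pi> k = act (i (r k)) (q k)" for k
  \<comment> \<open>The sign of \<open>q k\<close> at the sample point. Since \<open>i (r k)\<close>
    is constant on cosets, products of these signs reproduce the cocycle.\<close>
  define s where "s k = fst (i (r k) (q k))" for k
  have \<pi>: "\<pi> k = code (iso_point (\<rho> (q k)) (z k))" if "k \<in> K" for k
    unfolding \<pi>_def using act[OF q[OF that], of "z k"] z[OF that] by simp
  have s: "s k = iso_sign (\<rho> (q k)) (z k)" if "k \<in> K" for k
    unfolding s_def using q[OF that] by (simp add: code_def flip: z[OF that])
  have "\<pi> ` K = range code"
  proof (intro equalityI subsetI)
    fix p assume "p \<in> \<pi> ` K"
    then show "p \<in> range code" using \<pi> by blast
  next
    fix p assume "p \<in> range code"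
    then obtain t where t: "t \<in> R" "p = i t" using i unfolding P_def by blast
    \<comment> \<open>The representative itself: its \<open>H\<close>-part is the identity, so
      \<open>\<pi>\<close> returns \<open>i t\<close> unmoved.\<close>
    let ?k = "t \<otimes> \<one>"
    have k: "?k \<in> K" "q ?k = \<one>" "r ?k = t" using tm[OF t(1), of \<one>] by simp_all
    have "\<pi> ?k = code (z ?k)" using \<pi>[OF k(1)] k by (simp add: iso_point_one[OF \<rho>])
    then have "\<pi> ?k = p" using z[OF k(1)] k t by simp
    then show "p \<in> \<pi> ` K" using k by blast
  qed
  from finitely_determined_lift[OF code K(2) this]
  obtain \<alpha> where \<alpha>: "finitely_determined \<alpha>" "range \<alpha> = K" "\<And>x. \<pi> (\<alpha> x) = code x" by blast
  have equiv: "s (\<alpha> x) * s (\<alpha> y) = iso_sign (\<rho> h) x \<and> agree n y (iso_point (\<rho> h) x)"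
    if h: "h \<in> H" and y: "\<alpha> y = \<alpha> x \<otimes> h" for h x y
  proof -
    define k where "k = \<alpha> x"
    have k: "k \<in> K" "k \<otimes> h \<in> K" using \<alpha>(2) y unfolding k_def by (metis rangeI)+
    define u where "u = iso_point (\<rho> (q k)) (z k)"
    have x_u: "code x = code u" using \<pi>[OF k(1)] \<alpha>(3)[of x] by (simp add: k_def u_def)
    have qk: "q k \<in> H" using q k by blast
    have "i (r (k \<otimes> h)) = code (z k)" using qm[OF k(1) h] z[OF k(1)] by simp
    then have "\<pi> (k \<otimes> h) = code (iso_point (\<rho> (q k \<otimes> h)) (z k))"
      unfolding \<pi>_def using qm[OF k(1) h] qk h act[of "q k \<otimes> h" "z k"] by simp
    also have "\<dots> = code (iso_point (\<rho> h) u)"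
      using qk h by (simp add: iso_point_action[OF \<rho>] u_def)
    also have "\<dots> = code (iso_point (\<rho> h) x)" using act[OF h] x_u by simp
    finally have "code y = code (iso_point (\<rho> h) x)" using \<alpha>(3)[of y] y by (simp add: k_def)
    \<comment> \<open>The entry of a code at the identity holds the prefix of the point
      itself.\<close>
    then have "code y \<one> = code (iso_point (\<rho> h) x) \<one>" by simp
    then have "agree n y (iso_point (\<rho> h) x)"
      by (simp add: code_def iso_point_one[OF \<rho>] agree_iff_map_upt)
    moreover have "s (k \<otimes> h) = iso_sign (\<rho> (q k \<otimes> h)) (z k)"
      unfolding s_def using qm[OF k(1) h] qk h by (simp add: code_def flip: z[OF k(1)])
    then have "s k * s (k \<otimes> h) = iso_sign (\<rho> h) u"
      using s[OF k(1)] qk h iso_sign_cocycle[OF \<rho>, of "q k" h "z k"]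
        iso_sign_square[OF iso[OF qk], of "z k"]
      by (simp add: u_def flip: mult.assoc)
    moreover have "iso_sign (\<rho> h) u = iso_sign (\<rho> h) x"
      using fun_cong[OF x_u, of h] h by (simp add: code_def)
    ultimately show ?thesis using y by (simp add: k_def)
  qed
  have sign: "\<bar>s k\<bar> = 1" if "k \<in> K" for k using s[OF that] q[OF that] by simp
  show ?thesis
    by (rule exI[of _ K], rule exI[of _ \<alpha>], rule exI[of _ s], intro conjI)
       (use K \<alpha> equiv sign in blast)+
qed

section \<open>Actions from towers of codings\<close>

text \<open>Coherent codes are realised by a point: they freeze more and more coordinates, and each
  code reads only finitely many.\<close>

lemma coherent_sequence_limit:
  fixes \<alpha> :: "nat \<Rightarrow> (nat \<Rightarrow> bool) \<Rightarrow> 'k"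
  assumes fd: "\<And>n. finitely_determined (\<alpha> n)"
    and det: "\<And>n x y. \<alpha> (Suc n) x = \<alpha> (Suc n) y \<Longrightarrow> agree n x y"
    and desc: "\<And>n x y. \<alpha> (Suc n) x = \<alpha> (Suc n) y \<Longrightarrow> \<alpha> n x = \<alpha> n y"
    and coh: "\<And>n. m \<le> n \<Longrightarrow> \<alpha> n (X (Suc n)) = \<alpha> n (X n)"
  shows "\<exists>y. \<forall>n\<ge>m. \<alpha> n y = \<alpha> n (X n)"
proof -
  have desc': "\<alpha> n x = \<alpha> n y" if "\<alpha> l x = \<alpha> l y" "n \<le> l" for n l x y
    using that(2,1) by (induction rule: dec_induct) (auto dest: desc)
  have coh': "\<alpha> n (X l) = \<alpha> n (X n)" if "m \<le> n" "n \<le> l" for n l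
    using that(2)
  proof (induction rule: dec_induct)
    case (step l)
    then show ?case using desc'[OF coh[of l], of n] that by simp
  qed simp
  \<comment> \<open>A code at stage \<open>l\<close> fixes the coordinates below
    \<open>l - 1\<close>, so coordinate \<open>i\<close> is frozen from stage \<open>i + 2\<close>
    on.\<close>
  define y where "y i = X (max m (i + 2)) i" for i
  have agr: "agree N y (X (Suc N))" if "m \<le> Suc N" for N
    unfolding agree_def
  proof (intro allI impI)
    fix i assume "i < N"
    define l where "l = max m (i + 2)"
    have l: "m \<le> l" "l \<le> Suc N" "i < l - 1" "l = Suc (l - 1)" using that \<open>i < N\<close> by (auto simp: l_def)
    from coh'[OF l(1,2)] have "agree (l - 1) (X (Suc N)) (X l)" using det[of "l - 1"] l(4) by simp
    then show "y i = X (Suc N) i" using l(3) by (simp add: agree_def y_def l_def)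
  qed
  have "\<alpha> n y = \<alpha> n (X n)" if n: "m \<le> n" for n
  proof -
    obtain M where M: "\<And>x y. agree M x y \<Longrightarrow> \<alpha> n x = \<alpha> n y"
      using fd[of n] unfolding finitely_determined_def by blast
    let ?N = "max M n"
    have "agree M y (X (Suc ?N))" using agree_mono[OF agr[of ?N], of M] n by simp
    then have "\<alpha> n y = \<alpha> n (X (Suc ?N))" by (rule M)
    also have "\<dots> = \<alpha> n (X n)" by (rule coh'[OF n]) simp
    finally show ?thesis .
  qed
  then show ?thesis by blast
qed

text \<open>Each point of the Cantor space has a code in every \<open>K n\<close>; the group acts on the
codes by right multiplication, and this determines an action on points.\<close>

locale coding_tower = group G for G (structure) +
  fixes K :: "nat \<Rightarrow> 'a set" and \<alpha> :: "nat \<Rightarrow> (nat \<Rightarrow> bool) \<Rightarrow> 'a" and s :: "'a \<Rightarrow> real"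
  assumes subgroup_K: "subgroup (K n) G"
    and K_mono: "K n \<subseteq> K (Suc n)"
    and K_union: "(\<Union>n. K n) = carrier G"
    and fd: "finitely_determined (\<alpha> n)"
    and range_\<alpha>: "range (\<alpha> n) = K n"
    and det: "\<alpha> (Suc n) x = \<alpha> (Suc n) y \<Longrightarrow> agree n x y"
    and desc: "h \<in> K n \<Longrightarrow> \<alpha> (Suc n) y = \<alpha> (Suc n) x \<otimes> h \<Longrightarrow> \<alpha> n y = \<alpha> n x \<otimes> h"
    and sign: "k \<in> K 0 \<Longrightarrow> \<bar>s k\<bar> = 1"
begin

lemma mem_K_carrier [simp]: "k \<in> K n \<Longrightarrow> k \<in> carrier G"
  using K_union by blast

lemma \<alpha>_mem_K [simp]: "\<alpha> n x \<in> K n"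
  using range_\<alpha> by blast

lemma \<alpha>_carrier [simp]: "\<alpha> n x \<in> carrier G"
  using \<alpha>_mem_K mem_K_carrier by blast

lemma mem_K_mono: "k \<in> K m \<Longrightarrow> m \<le> n \<Longrightarrow> k \<in> K n"
  using lift_Suc_mono_le[of K, OF K_mono] by blast

lemma desc_eq: "\<alpha> (Suc n) x = \<alpha> (Suc n) y \<Longrightarrow> \<alpha> n x = \<alpha> n y"
  using desc[of \<one> n x y] subgroup.one_closed[OF subgroup_K] by simp

lemma eq_if_codes_eq:
  assumes "\<And>n. m \<le> n \<Longrightarrow> \<alpha> n x = \<alpha> n y"
  shows "x = y"
proof (rule agree_all_imp_eq)
  fix n
  have "agree (max m n) x y" by (rule det) (simp add: assms)
  then show "agree n x y" by (rule agree_mono) simp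
qed

text \<open>Right multiples of the codes of \<open>x\<close> by \<open>g\<close> are coherent by
  \<open>desc\<close> from the first stage whose group contains \<open>g\<close>; each is attained
  because the codings are onto.\<close>

lemma exists_translate:
  assumes g: "g \<in> carrier G"
  shows "\<exists>y. \<forall>n. g \<in> K n \<longrightarrow> \<alpha> n y = \<alpha> n x \<otimes> g"
proof -
  define m where "m = (LEAST n. g \<in> K n)"
  have "\<exists>n. g \<in> K n" using g K_union by blast
  then have "g \<in> K m" unfolding m_def by (rule LeastI_ex)
  then have gK: "g \<in> K n \<longleftrightarrow> m \<le> n" for n
    unfolding m_def using Least_le[of "\<lambda>n. g \<in> K n" n] mem_K_mono[of g _ n] by blast
  have "\<exists>z. m \<le> n \<longrightarrow> \<alpha> n z = \<alpha> n x \<otimes> g" for n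
  proof (cases "m \<le> n")
    case True
    then have "\<alpha> n x \<otimes> g \<in> K n" using gK subgroup.m_closed[OF subgroup_K] by simp
    then obtain z where "\<alpha> n z = \<alpha> n x \<otimes> g" using range_\<alpha> by (metis imageE)
    then show ?thesis by blast
  qed simp
  then obtain X where X: "\<And>n. m \<le> n \<Longrightarrow> \<alpha> n (X n) = \<alpha> n x \<otimes> g" by metis
  have "\<exists>y. \<forall>n\<ge>m. \<alpha> n y = \<alpha> n (X n)"
  proof (rule coherent_sequence_limit[OF fd det desc_eq])
    show "\<alpha> n (X (Suc n)) = \<alpha> n (X n)" if "m \<le> n" for n
      using that gK X desc[of g n "X (Suc n)" x] by simp
  qed
  then show ?thesis using gK X by auto
qed

text \<open>The chosen point is unique, since late codes separate points. Identities between
  translates are therefore proved by comparing codes.\<close>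

definition translate :: "'a \<Rightarrow> (nat \<Rightarrow> bool) \<Rightarrow> nat \<Rightarrow> bool" where
  "translate g x = (SOME y. \<forall>n. g \<in> K n \<longrightarrow> \<alpha> n y = \<alpha> n x \<otimes> g)"

lemma \<alpha>_translate:
  assumes "g \<in> K n"
  shows "\<alpha> n (translate g x) = \<alpha> n x \<otimes> g"
  using someI_ex[OF exists_translate[OF mem_K_carrier[OF assms]], of x] assms
  unfolding translate_def by blast

lemma translate_mult:
  assumes "g \<in> carrier G" "h \<in> carrier G"
  shows "translate (g \<otimes> h) x = translate h (translate g x)"
proof -
  obtain i j where ij: "g \<in> K i" "h \<in> K j" using assms K_union by blast
  show ?thesis
  proof (rule eq_if_codes_eq[where m = "max i j"])
    fix n assume "max i j \<le> n"
    then have "g \<in> K n" "h \<in> K n" using ij mem_K_mono by auto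
    moreover from this have "g \<otimes> h \<in> K n" using subgroup.m_closed[OF subgroup_K] by blast
    ultimately show "\<alpha> n (translate (g \<otimes> h) x) = \<alpha> n (translate h (translate g x))"
      using assms by (simp add: \<alpha>_translate m_assoc)
  qed
qed

lemma translate_one: "translate \<one> x = x"
  by (rule eq_if_codes_eq[where m = 0]) (simp add: \<alpha>_translate subgroup.one_closed[OF subgroup_K])

text \<open>The code of the translate is a function of the code of \<open>x\<close> at the same
  stage, and that code reads finitely many coordinates.\<close>

lemma translate_uniform:
  assumes "g \<in> carrier G"
  shows "\<exists>M. \<forall>x y. agree M x y \<longrightarrow> agree N (translate g x) (translate g y)"
proof -
  obtain i where i: "g \<in> K i" using assms K_union by blast
  define n where "n = max i N"
  have g: "g \<in> K (Suc n)" using i mem_K_mono[of g i "Suc n"] by (simp add: n_def)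
  obtain M where M: "\<And>x y. agree M x y \<Longrightarrow> \<alpha> (Suc n) x = \<alpha> (Suc n) y"
    using fd[of "Suc n"] unfolding finitely_determined_def by blast
  have "agree N (translate g x) (translate g y)" if "agree M x y" for x y
  proof -
    have "agree n (translate g x) (translate g y)"
      by (rule det) (simp add: \<alpha>_translate[OF g] M[OF that])
    then show ?thesis by (rule agree_mono) (simp add: n_def)
  qed
  then show ?thesis by blast
qed

text \<open>The product of the weights at \<open>x\<close> and at its translate is a coboundary, so
  it satisfies the cocycle identity automatically.\<close>

definition weight :: "(nat \<Rightarrow> bool) \<Rightarrow> real" where
  "weight x = s (\<alpha> 0 x)"

lemma abs_weight [simp]: "\<bar>weight x\<bar> = 1"
  by (simp add: weight_def sign)

lemma weight_square [simp]: "weight x * weight x = 1"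
  by (metis abs_weight abs_mult_self_eq mult_1)

lemma weight_square_left [simp]: "weight x * (weight x * c) = c"
  by (simp flip: mult.assoc)

text \<open>The restriction to the carrier makes the map extensional, as points of the product
  topology must be.\<close>

definition tower_action :: "'a \<Rightarrow> cantor_C \<Rightarrow> cantor_C" where
  "tower_action = (\<lambda>g\<in>carrier G. \<lambda>f :: cantor_C.
     Bcontfun (\<lambda>x. weight x * weight (translate g x) * f (translate g x)))"

lemma tower_action_apply:
  assumes g: "g \<in> carrier G"
  shows "tower_action g f x = weight x * weight (translate g x) * f (translate g x)"
proof -
  have "continuous_on UNIV (\<lambda>x. weight x * weight (translate g x) * f (translate g x))"
    unfolding continuous_cantor_iff
  proof (intro allI impI)
    fix e :: real assume e: "e > 0"
    obtain N where N: "\<And>x y. agree N x y \<Longrightarrow> \<bar>f x - f y\<bar> < e"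
      using cantor_C_uniform[OF e, of f] by metis
    obtain L where L: "\<And>x y. agree L x y \<Longrightarrow> weight x = weight y"
      using fd[of 0] unfolding finitely_determined_def weight_def by metis
    obtain M where M: "\<And>x y. agree M x y \<Longrightarrow> agree (max L N) (translate g x) (translate g y)"
      using translate_uniform[OF g] by metis
    have "\<bar>weight x * weight (translate g x) * f (translate g x)
        - weight y * weight (translate g y) * f (translate g y)\<bar> < e"
      if xy: "agree (max L M) x y" for x y
    proof -
      have "agree L x y" "agree M x y" using xy by (auto elim: agree_mono)
      moreover from M[OF this(2)]
      have "agree L (translate g x) (translate g y)" "agree N (translate g x) (translate g y)"
        by (auto elim: agree_mono)
      ultimately have "weight x = weight y" "weight (translate g x) = weight (translate g y)"
        "\<bar>f (translate g x) - f (translate g y)\<bar> < e" using L N by auto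
      moreover have "\<bar>weight y * weight (translate g y) * f (translate g x)
        - weight y * weight (translate g y) * f (translate g y)\<bar>
        = \<bar>f (translate g x) - f (translate g y)\<bar>"
        by (simp add: abs_mult flip: right_diff_distrib)
      ultimately show ?thesis by simp
    qed
    then show "\<exists>N. \<forall>x y. agree N x y \<longrightarrow>
      \<bar>weight x * weight (translate g x) * f (translate g x)
        - weight y * weight (translate g y) * f (translate g y)\<bar> < e" by blast
  qed
  then show ?thesis using g by (simp add: tower_action_def)
qed

lemma tower_action_mult:
  assumes "g \<in> carrier G" "h \<in> carrier G"
  shows "tower_action (g \<otimes> h) f = tower_action g (tower_action h f)"
  by (rule bcontfun_eqI) (simp add: assms tower_action_apply translate_mult mult.assoc)

lemma tower_action_one: "tower_action \<one> f = f"
  by (rule bcontfun_eqI) (simp add: tower_action_apply translate_one)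

lemma tower_action_Iso_C:
  assumes g: "g \<in> carrier G"
  shows "tower_action g \<in> Iso_C"
proof -
  \<comment> \<open>Being contractive for every group element, hence also for the inverse, makes the
    operator isometric.\<close>
  have le: "norm (tower_action h f) \<le> norm f" if "h \<in> carrier G" for h f
  proof (rule norm_cantor_C_le)
    fix x show "\<bar>tower_action h f x\<bar> \<le> norm f"
      using abs_le_norm_cantor_C[of f "translate h x"]
      by (simp add: tower_action_apply[OF that] abs_mult)
  qed
  have inv: "tower_action g (tower_action (inv g) f) = f" "tower_action (inv g) (tower_action g f) = f" for f
    using g tower_action_mult[of g "inv g" f] tower_action_mult[of "inv g" g f]
    by (simp_all add: tower_action_one)
  have "linear (tower_action g)"
    by (intro linearI bcontfun_eqI) (simp_all add: tower_action_apply[OF g] algebra_simps)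
  moreover have "surj (tower_action g)" by (metis inv(1) surjI)
  moreover have "norm (tower_action g f) = norm f" for f
    using le[OF g, of f] le[of "inv g" "tower_action g f"] g inv(2)[of f] by simp
  ultimately show ?thesis by (simp add: Iso_C_def)
qed

lemma tower_action_Act_top: "tower_action \<in> topspace (Act_top G)"
  unfolding topspace_Act_top
proof (intro conjI ballI)
  show "tower_action \<in> carrier G \<rightarrow>\<^sub>E Iso_C"
    using tower_action_Iso_C by (auto simp: PiE_iff tower_action_def extensional_def)
  show "tower_action (g \<otimes> h) = tower_action g \<circ> tower_action h"
    if "g \<in> carrier G" "h \<in> carrier G" for g h
    using that by (auto simp: tower_action_mult)
qed

text \<open>A finite group acts transitively on itself: some element of \<open>K ?n\<close> carries
  the code of \<open>x\<close> to that of a point in the cylinder.\<close>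

lemma tower_action_syndetic:
  assumes fin: "\<And>n. finite (K n)"
  shows "syndetic_on G tower_action w"
proof -
  \<comment> \<open>Codes at stage \<open>Suc n\<close> determine \<open>n\<close> coordinates, here
    as many as \<open>w\<close> has.\<close>
  let ?n = "Suc (length w)"
  define x0 where "x0 i = (i < length w \<and> w ! i)" for i
  have x0: "map x0 [0..<length w] = w" by (rule nth_equalityI) (auto simp: x0_def)
  have "\<exists>g\<in>K ?n. tower_action g (cylinder w) x \<noteq> 0" for x
  proof -
    define g where "g = inv (\<alpha> ?n x) \<otimes> \<alpha> ?n x0"
    have g: "g \<in> K ?n"
      unfolding g_def by (intro subgroup.m_closed[OF subgroup_K] subgroup.m_inv_closed[OF subgroup_K]) simp_all
    have "\<alpha> ?n (translate g x) = \<alpha> ?n x0"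
      by (simp add: \<alpha>_translate[OF g]) (simp add: g_def flip: m_assoc)
    then have "agree (length w) (translate g x) x0" by (rule det)
    then have "map (translate g x) [0..<length w] = w" using x0 by (simp only: agree_iff_map_upt)
    then have "cylinder w (translate g x) = 1" by (simp only: cylinder_apply simp_thms of_bool_eq)
    then have "\<bar>tower_action g (cylinder w) x\<bar> = 1"
      by (simp only: tower_action_apply[OF mem_K_carrier[OF g]] abs_mult abs_weight abs_one mult_1)
    then show ?thesis using g by (intro bexI[of _ g]) auto
  qed
  then show ?thesis
    unfolding syndetic_on_def using fin by (intro exI[of _ "K ?n"]) auto
qed

end

section \<open>Existence of towers and density of syndetic actions\<close>

text \<open>\<open>refine_coding\<close> is iterated by dependent choice; step \<open>n\<close> also
  adjoins \<open>e n\<close>, so the subgroups exhaust the group.\<close>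

lemma (in group) coding_tower_exists:
  assumes inf: "infinite (carrier G)" and cnt: "countable (carrier G)" and lf: "locally_finite_group G"
    and K0: "subgroup K0 G" "finite K0" "finitely_determined \<alpha>0" "range \<alpha>0 = K0"
    and sign: "\<And>k. k \<in> K0 \<Longrightarrow> \<bar>s k\<bar> = 1"
  shows "\<exists>K \<alpha>. coding_tower G K \<alpha> s \<and> K 0 = K0 \<and> \<alpha> 0 = \<alpha>0 \<and> (\<forall>n. finite (K n))"
proof -
  define e where "e = from_nat_into (carrier G)"
  have e: "range e = carrier G"
    unfolding e_def using range_from_nat_into[OF _ cnt] one_closed by blast
  have e_in: "e n \<in> carrier G" for n using e by blast
  \<comment> \<open>A state is a subgroup with its coding. The clause for \<open>n = 0\<close> pins
    the start of the sequence to the given pair.\<close>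
  let ?P = "\<lambda>n st. subgroup (fst st) G \<and> finite (fst st) \<and> finitely_determined (snd st) \<and>
      range (snd st) = fst st \<and> (n = 0 \<longrightarrow> st = (K0, \<alpha>0))"
  let ?Q = "\<lambda>n st st'. fst st \<subseteq> fst st' \<and> e n \<in> fst st' \<and>
      (\<forall>x y. snd st' x = snd st' y \<longrightarrow> agree n x y) \<and>
      (\<forall>x y. \<forall>h\<in>fst st. snd st' y = snd st' x \<otimes> h \<longrightarrow> snd st y = snd st x \<otimes> h)"
  have "\<exists>st. \<forall>n. ?P n (st n) \<and> ?Q n (st n) (st (Suc n))"
  proof (rule dependent_nat_choice)
    show "\<exists>st. ?P 0 st" using K0 by (intro exI[of _ "(K0, \<alpha>0)"]) simp
    fix st and n :: nat assume P: "?P n st"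
    have "\<exists>K \<alpha>'. subgroup K G \<and> finite K \<and> finitely_determined \<alpha>' \<and> range \<alpha>' = K \<and>
      fst st \<subseteq> K \<and> e n \<in> K \<and> (\<forall>x y. \<alpha>' x = \<alpha>' y \<longrightarrow> agree n x y) \<and>
      (\<forall>x y. \<forall>h\<in>fst st. \<alpha>' y = \<alpha>' x \<otimes> h \<longrightarrow> snd st y = snd st x \<otimes> h)"
      by (rule refine_coding[OF inf lf]) (use P e_in in simp_all)
    then obtain K \<alpha>' where "subgroup K G" "finite K" "finitely_determined \<alpha>'" "range \<alpha>' = K"
      "fst st \<subseteq> K" "e n \<in> K" "\<forall>x y. \<alpha>' x = \<alpha>' y \<longrightarrow> agree n x y"
      "\<forall>x y. \<forall>h\<in>fst st. \<alpha>' y = \<alpha>' x \<otimes> h \<longrightarrow> snd st y = snd st x \<otimes> h"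
      by (elim exE conjE)
    then show "\<exists>st'. ?P (Suc n) st' \<and> ?Q n st st'"
      by (intro exI[of _ "(K, \<alpha>')"]) simp
  qed
  then obtain st where st: "\<forall>n. ?P n (st n) \<and> ?Q n (st n) (st (Suc n))" ..
  note P = st[rule_format, THEN conjunct1] and Q = st[rule_format, THEN conjunct2]
  have union: "(\<Union>n. fst (st n)) = carrier G"
  proof
    have "fst (st n) \<subseteq> carrier G" for n using subgroup.subset P[of n] by blast
    then show "(\<Union>n. fst (st n)) \<subseteq> carrier G" by blast
    have "e n \<in> fst (st (Suc n))" for n using Q[of n] by simp
    then show "carrier G \<subseteq> (\<Union>n. fst (st n))" unfolding e[symmetric] by blast
  qed
  have st0: "st 0 = (K0, \<alpha>0)" using P[of 0] by simp
  have "coding_tower G (\<lambda>n. fst (st n)) (\<lambda>n. snd (st n)) s"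
  proof (intro coding_tower.intro coding_tower_axioms.intro)
    fix n x y h
    show "group G" by (rule group_axioms)
    show "subgroup (fst (st n)) G" "finitely_determined (snd (st n))" "range (snd (st n)) = fst (st n)"
      using P[of n] by simp_all
    show "fst (st n) \<subseteq> fst (st (Suc n))" using Q[of n] by simp
    show "(\<Union>n. fst (st n)) = carrier G" by (rule union)
    show "snd (st (Suc n)) x = snd (st (Suc n)) y \<Longrightarrow> agree n x y" using Q[of n] by blast
    show "h \<in> fst (st n) \<Longrightarrow> snd (st (Suc n)) y = snd (st (Suc n)) x \<otimes> h \<Longrightarrow>
      snd (st n) y = snd (st n) x \<otimes> h" using Q[of n] by blast
    show "h \<in> fst (st 0) \<Longrightarrow> \<bar>s h\<bar> = 1" using sign st0 by simp
  qed
  moreover have "finite (fst (st n))" for n using P[of n] by simp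
  ultimately show ?thesis
    using st0 by (intro exI[of _ "\<lambda>n. fst (st n)"] exI[of _ "\<lambda>n. snd (st n)"]) auto
qed

text \<open>On \<open>H\<close> the signs agree exactly and only the points differ, beyond depth
  \<open>n\<close>. Stating the error through the variation of \<open>f\<close> lets one
  \<open>\<sigma>\<close> serve all \<open>f\<close>.\<close>

lemma (in group) syndetic_approximation:
  assumes inf: "infinite (carrier G)" and cnt: "countable (carrier G)" and lf: "locally_finite_group G"
    and \<rho>: "\<rho> \<in> topspace (Act_top G)" and H: "subgroup H G" "finite H"
  shows "\<exists>\<sigma>\<in>topspace (Act_top G). (\<forall>w. syndetic_on G \<sigma> w) \<and>
    (\<forall>h\<in>H. \<forall>f x. \<exists>u v. agree n u v \<and> \<bar>\<sigma> h f x - \<rho> h f x\<bar> \<le> \<bar>f u - f v\<bar>)"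
proof -
  obtain K0 \<alpha>0 s where K0: "subgroup K0 G" "finite K0" "finitely_determined \<alpha>0" "range \<alpha>0 = K0"
    and HK: "H \<subseteq> K0" and s: "\<forall>k\<in>K0. \<bar>s k :: real\<bar> = 1"
    and eq: "\<forall>h\<in>H. \<forall>x y. \<alpha>0 y = \<alpha>0 x \<otimes> h \<longrightarrow>
      s (\<alpha>0 x) * s (\<alpha>0 y) = iso_sign (\<rho> h) x \<and> agree n y (iso_point (\<rho> h) x)"
    using initial_coding[OF inf lf \<rho> H, of n] by (elim exE conjE)
  obtain K \<alpha> where tower: "coding_tower G K \<alpha> s" and init: "K 0 = K0" "\<alpha> 0 = \<alpha>0"
    and fin: "\<And>n. finite (K n)"
    using coding_tower_exists[OF inf cnt lf K0, of s] s by auto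
  interpret coding_tower G K \<alpha> s by (rule tower)
  have "\<exists>u v. agree n u v \<and> \<bar>tower_action h f x - \<rho> h f x\<bar> \<le> \<bar>f u - f v\<bar>" if h: "h \<in> H" for h f x
  proof -
    have hK: "h \<in> K 0" using h HK init by blast
    have iso: "\<rho> h \<in> Iso_C" by (rule Act_topD(1)[OF \<rho> mem_K_carrier[OF hK]])
    have "\<alpha>0 (translate h x) = \<alpha>0 x \<otimes> h" using \<alpha>_translate[OF hK] init by simp
    then have "weight x * weight (translate h x) = iso_sign (\<rho> h) x"
      and agr: "agree n (translate h x) (iso_point (\<rho> h) x)"
      using eq h by (auto simp: weight_def init)
    then have "tower_action h f x - \<rho> h f x
        = iso_sign (\<rho> h) x * (f (translate h x) - f (iso_point (\<rho> h) x))"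
      by (simp add: tower_action_apply[OF mem_K_carrier[OF hK]] banach_stone[OF iso] algebra_simps)
    then have "\<bar>tower_action h f x - \<rho> h f x\<bar> = \<bar>f (translate h x) - f (iso_point (\<rho> h) x)\<bar>"
      using iso by (simp add: abs_mult)
    then show ?thesis using agr by (metis order_refl)
  qed
  then show ?thesis using tower_action_Act_top tower_action_syndetic[OF fin] by blast
qed

section \<open>Comeagerness\<close>

theorem theorem6p4:
  fixes G :: "('g, 'b) monoid_scheme"
  assumes "group G" and "countable (carrier G)" and "locally_finite_group G"
  shows "comeager_in (Act_top G)
           {\<rho> \<in> topspace (Act_top G). \<exists>N :: cantor_C \<Rightarrow> real.
              equivalent_norm N \<and> invariant_norm (carrier G) \<rho> N \<and> strictly_convex_norm N}"
    (is "comeager_in _ ?A")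
proof -
  interpret group G by fact
  obtain K where K: "\<And>n :: nat. subgroup (K n) G" "\<And>n. finite (K n)" "\<And>n. K n \<subseteq> K (Suc n)"
    "(\<Union>n. K n) = carrier G"
    using locally_finite_chain[OF assms(2,3)] by metis
  show ?thesis
  proof (cases "finite (carrier G)")
    case True
    have "\<rho> \<in> ?A" if "\<rho> \<in> topspace (Act_top G)" for \<rho>
      using exists_invariant_strictly_convex_norm[OF that K finite_imp_form_avg_ge[OF that True K(1,3,4)]]
        that by simp
    \<comment> \<open>Every action of a finite group qualifies, so the complement is empty and the
      empty family covers it.\<close>
    then show ?thesis unfolding comeager_in_def meager_in_def by (intro exI[of _ "{}"]) auto
  next
    case False
    let ?O = "\<lambda>w. {\<rho> \<in> topspace (Act_top G). syndetic_on G \<rho> w}"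
    have "\<rho> \<in> ?A" if "\<rho> \<in> topspace (Act_top G)" "\<And>w. syndetic_on G \<rho> w" for \<rho>
      using exists_invariant_strictly_convex_norm[OF that(1) K syndetic_imp_form_avg_ge[OF that(1) K that(2)]]
        that(1) by simp
    \<comment> \<open>The union is countable, being indexed by finite boolean words.\<close>
    then have "topspace (Act_top G) - ?A \<subseteq> (\<Union>w. topspace (Act_top G) - ?O w)"
      by fastforce
    moreover have "nowhere_dense_in (Act_top G) (topspace (Act_top G) - ?O w)" for w
    proof (rule nowhere_dense_in_compl_open[OF openin_syndetic])
      fix \<rho> assume \<rho>: "\<rho> \<in> topspace (Act_top G)"
      obtain \<sigma> where \<sigma>: "\<And>n. \<sigma> n \<in> topspace (Act_top G)" "\<And>n w. syndetic_on G (\<sigma> n) w"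
        and app: "\<And>n h f x. h \<in> K n \<Longrightarrow>
          \<exists>u v. agree n u v \<and> \<bar>\<sigma> n h f x - \<rho> h f x\<bar> \<le> \<bar>apply_bcontfun f u - apply_bcontfun f v\<bar>"
      proof -
        have "\<forall>n. \<exists>\<sigma>. \<sigma> \<in> topspace (Act_top G) \<and> (\<forall>w. syndetic_on G \<sigma> w) \<and>
          (\<forall>h\<in>K n. \<forall>f x. \<exists>u v. agree n u v \<and> \<bar>\<sigma> h f x - \<rho> h f x\<bar> \<le> \<bar>f u - f v\<bar>)"
          using syndetic_approximation[OF False assms(2,3) \<rho> K(1,2)] by blast
        from choice[OF this] show ?thesis using that by blast
      qed
      \<comment> \<open>Here \<open>\<sigma> n\<close> approximates on \<open>K n\<close> to depth
        \<open>n\<close>: a fixed \<open>g\<close> eventually lies in \<open>K n\<close>, and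
        \<open>n\<close> eventually exceeds the depth required by \<open>f\<close>.\<close>
      have "limitin (Act_top G) \<sigma> \<rho> sequentially"
      proof (rule limitin_Act_top[OF \<rho> \<sigma>(1)])
        fix g f assume "g \<in> carrier G"
        then obtain m where m: "\<And>n. n \<ge> m \<Longrightarrow> g \<in> K n"
          using finite_subset_chain[of K "{g}"] K by auto
        show "(\<lambda>n. \<sigma> n g f) \<longlonglongrightarrow> \<rho> g f"
        proof (rule metric_LIMSEQ_I)
          fix e :: real assume e: "e > 0"
          obtain l where l: "\<And>x y. agree l x y \<Longrightarrow> \<bar>f x - f y\<bar> < e / 2"
            using cantor_C_uniform[of "e / 2" f] e by (metis half_gt_zero)
          have "dist (\<sigma> n g f) (\<rho> g f) < e" if n: "n \<ge> max m l" for n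
          proof -
            have "dist (\<sigma> n g f x) (\<rho> g f x) \<le> e / 2" for x
            proof -
              obtain u v where uv: "agree n u v" "\<bar>\<sigma> n g f x - \<rho> g f x\<bar> \<le> \<bar>f u - f v\<bar>"
                using app[OF m[of n]] n by fastforce
              have "agree l u v" using agree_mono[OF uv(1)] n by simp
              from l[OF this] uv(2) show ?thesis by (simp add: dist_real_def)
            qed
            from dist_bound[OF this] e show ?thesis by linarith
          qed
          then show "\<exists>no. \<forall>n\<ge>no. dist (\<sigma> n g f) (\<rho> g f) < e" by blast
        qed
      qed
      then show "\<exists>s. limitin (Act_top G) s \<rho> sequentially \<and> (\<forall>n. s n \<in> ?O w)"
        using \<sigma> by blast
    qed
    ultimately show ?thesis
      unfolding comeager_in_def meager_in_def
      by (intro exI[of _ "range (\<lambda>w. topspace (Act_top G) - ?O w)"] conjI ballI) auto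
  qed
qed

end
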